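(* Let $n\ge1$, $0<p<p_n^*$. If $u$ is a breather solution of the focusing nonlinear Schrödinger equation $$iu_t+\Delta u=-|u|^pu,\qquad (t,x)\in\mathbb{R}\times\mathbb{R}^n,$$ then $P[u]=0$ and one of the following holds: (1) $E[u]<0$ and $p<4/n$; (2) $E[u]=0$ and $p=4/n$; (3) $E[u]>0$ and $4/n<p<p_n^*$.
   Context: The energy critical power is $p_n^*=\infty$ for $n=1,2$ and $p_n^*=\frac{4}{n-2}$ for $n\ge 3$. The conserved energy and momentum are $$E[u]=\|\nabla_x u\|_{L^2}^2-\frac{2}{p+2}\|u\|_{L^{p+2}}^{p+2},\qquad P[u]=\mathrm{Im}\int_{\mathbb{R}^n}\bar u\,\nabla_x u\,dx .$$ Let $Q$ be the ground state, i.e. the unique (up to symmetries) positive radial, exponentially decaying $H^1(\mathbb{R}^n)$ solution of $-\Delta Q+Q-|Q|^pQ=0$. For $\omega>0$ let $Q_\omega(x)=\omega^{1/p}Q(\sqrt{\omega}\,x)$, which solves $-\Delta Q_\omega+\omega Q_\omega-|Q_\omega|^pQ_\omega=0$. Breather (with zero background): a solution $u:\mathbb{R}\times\mathbb{R}^n\to\mathbb{C}$ of the equation, not identically zero, for which there exist $\omega,C,\gamma>0$ such that, writing $u(t,x)=e^{i\omega t}\big(Q_\omega(x)+z(t,x)\big)$, the function $z$ is a nontrivial ($z\not\equiv0$) solution of $iz_t-\omega z+\Delta z=-|Q_\omega+z|^p(Q_\omega+z)+|Q_\omega|^pQ_\omega$ and: (i) $u(t+2\pi/\omega,x)=u(t,x)$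 for all $(t,x)\in\mathbb{R}\times\mathbb{R}^n$; (ii) $z(t,\cdot)\in C^\infty(\mathbb{R}^n)\cap H^1(\mathbb{R}^n)$ for all $t\in\mathbb{R}$; (iii) $\sup_{t\in\mathbb{R}}|D_x^\alpha z(t,x)|\le Ce^{-\gamma|x|}$ for all $x\in\mathbb{R}^n$ and all multi-indices $|\alpha|\le 2$. *)

theory Defs
  imports "HOL-Analysis.Analysis"
begin

section \<open>Derivatives in the space variable\<close>

definition partial :: "'n::finite \<Rightarrow> (real^'n \<Rightarrow> 'b::real_normed_vector) \<Rightarrow> real^'n \<Rightarrow> 'b" where
  "partial i f x = frechet_derivative f (at x) (axis i 1)"

text \<open>Iterated partial derivatives along a list of coordinate directions. For functions of class
  \<open>C\<^sup>k\<close> mixed partials commute, so the lists of length \<open>\<le> k\<close> enumerate (with repetition) exactly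
  the derivatives \<open>D\<^sup>\<alpha>\<close> for multi-indices with \<open>\<bar>\<alpha>\<bar> \<le> k\<close>.\<close>

definition iter_partial :: "'n::finite list \<Rightarrow> (real^'n \<Rightarrow> 'b::real_normed_vector) \<Rightarrow> real^'n \<Rightarrow> 'b" where
  "iter_partial is f = foldr partial is f"

definition laplacian :: "(real^'n::finite \<Rightarrow> 'b::real_normed_vector) \<Rightarrow> real^'n \<Rightarrow> 'b" where
  "laplacian f x = (\<Sum>i\<in>UNIV. partial i (partial i f) x)"

primrec C_k :: "nat \<Rightarrow> (real^'n::finite \<Rightarrow> 'b::real_normed_vector) \<Rightarrow> bool" where
  "C_k 0 f \<longleftrightarrow> continuous_on UNIV f"
| "C_k (Suc k) f \<longleftrightarrow> (\<forall>x. f differentiable at x) \<and> (\<forall>i. C_k k (partial i f))"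

definition smooth :: "(real^'n::finite \<Rightarrow> 'b::real_normed_vector) \<Rightarrow> bool" where
  "smooth f \<longleftrightarrow> (\<forall>k. C_k k f)"


section \<open>The Sobolev space \<open>H\<^sup>1\<close>\<close>

definition test_function :: "(real^'n::finite \<Rightarrow> real) \<Rightarrow> bool" where
  "test_function \<phi> \<longleftrightarrow> smooth \<phi> \<and> bounded {x. \<phi> x \<noteq> 0}"

definition square_integrable ::
    "(real^'n::finite \<Rightarrow> 'b::{banach, second_countable_topology}) \<Rightarrow> bool" where
  "square_integrable f \<longleftrightarrow> f \<in> borel_measurable lborel \<and> integrable lborel (\<lambda>x. (norm (f x))\<^sup>2)"

definition weak_partial :: "'n::finite \<Rightarrow> (real^'n \<Rightarrow> 'b::{banach, second_countable_topology})
    \<Rightarrow> (real^'n \<Rightarrow> 'b) \<Rightarrow> bool" where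
  "weak_partial i f g \<longleftrightarrow> (\<forall>\<phi>. test_function \<phi> \<longrightarrow>
     (LINT x|lborel. partial i \<phi> x *\<^sub>R f x) = - (LINT x|lborel. \<phi> x *\<^sub>R g x))"

definition H1 :: "(real^'n::finite \<Rightarrow> 'b::{banach, second_countable_topology}) \<Rightarrow> bool" where
  "H1 f \<longleftrightarrow> square_integrable f \<and> (\<forall>i. \<exists>g. square_integrable g \<and> weak_partial i f g)"


section \<open>Critical power, energy and momentum\<close>

definition energy_critical_power :: "nat \<Rightarrow> ereal" where
  "energy_critical_power n = (if n \<le> 2 then \<infinity> else ereal (4 / (real n - 2)))"

definition energy :: "real \<Rightarrow> (real^'n::finite \<Rightarrow> complex) \<Rightarrow> real" where
  "energy p f = (LINT x|lborel. (\<Sum>i\<in>UNIV. (norm (partial i f x))\<^sup>2))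
     - 2 / (p + 2) * (LINT x|lborel. norm (f x) powr (p + 2))"

definition momentum :: "(real^'n::finite \<Rightarrow> complex) \<Rightarrow> real^'n" where
  "momentum f = (\<chi> i. Im (LINT x|lborel. cnj (f x) * partial i f x))"


section \<open>The ground state\<close>

text \<open>Positivity together with radial symmetry about the origin removes the phase and translation
  symmetries, so this predicate characterizes \<open>Q\<close> uniquely.\<close>

definition ground_state :: "real \<Rightarrow> (real^'n::finite \<Rightarrow> real) \<Rightarrow> bool" where
  "ground_state p Q \<longleftrightarrow>
     (\<forall>x. 0 < Q x) \<and>
     (\<forall>x y. norm x = norm y \<longrightarrow> Q x = Q y) \<and>
     (\<exists>C>0. \<exists>\<gamma>>0. \<forall>x. \<bar>Q x\<bar> \<le> C * exp (- \<gamma> * norm x)) \<and>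
     H1 Q \<and> C_k 2 Q \<and>
     (\<forall>x. - laplacian Q x + Q x - \<bar>Q x\<bar> powr p * Q x = 0)"

definition rescale :: "real \<Rightarrow> real \<Rightarrow> (real^'n::finite \<Rightarrow> real) \<Rightarrow> real^'n \<Rightarrow> real" where
  "rescale p \<omega> Q x = \<omega> powr (1 / p) * Q (sqrt \<omega> *\<^sub>R x)"


section \<open>Solutions and breathers\<close>

text \<open>Solutions are classical: \<open>C\<^sup>2\<close> in space at each time, differentiable in time at each point,
  and the equation holds pointwise. No continuity of the time derivative is demanded.\<close>

definition NLS_solution :: "real \<Rightarrow> (real \<Rightarrow> real^'n::finite \<Rightarrow> complex) \<Rightarrow> bool" where
  "NLS_solution p u \<longleftrightarrow>
     (\<forall>t. C_k 2 (u t)) \<and>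
     (\<forall>t x. \<exists>ut. ((\<lambda>s. u s x) has_vector_derivative ut) (at t) \<and>
        \<i> * ut + laplacian (u t) x = - (of_real (norm (u t x) powr p) * u t x))"

definition perturbation_solution ::
    "real \<Rightarrow> real \<Rightarrow> (real^'n::finite \<Rightarrow> real) \<Rightarrow> (real \<Rightarrow> real^'n \<Rightarrow> complex) \<Rightarrow> bool" where
  "perturbation_solution p \<omega> Q\<omega> z \<longleftrightarrow>
     (\<forall>t. C_k 2 (z t)) \<and>
     (\<forall>t x. \<exists>zt. ((\<lambda>s. z s x) has_vector_derivative zt) (at t) \<and>
        \<i> * zt - of_real \<omega> * z t x + laplacian (z t) x =
          - (of_real (norm (of_real (Q\<omega> x) + z t x) powr p) * (of_real (Q\<omega> x) + z t x))
          + of_real (\<bar>Q\<omega> x\<bar> powr p * Q\<omega> x))"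

definition breather ::
    "real \<Rightarrow> (real^'n::finite \<Rightarrow> real) \<Rightarrow> (real \<Rightarrow> real^'n \<Rightarrow> complex) \<Rightarrow> bool" where
  "breather p Q u \<longleftrightarrow>
     NLS_solution p u \<and>
     (\<exists>t x. u t x \<noteq> 0) \<and>
     (\<exists>\<omega>>0. \<exists>C>0. \<exists>\<gamma>>0. \<exists>z.
        (\<forall>t x. u t x = exp (\<i> * of_real (\<omega> * t)) * (of_real (rescale p \<omega> Q x) + z t x)) \<and>
        perturbation_solution p \<omega> (rescale p \<omega> Q) z \<and>
        (\<exists>t x. z t x \<noteq> 0) \<and>
        (\<forall>t x. u (t + 2 * pi / \<omega>) x = u t x) \<and>
        (\<forall>t. smooth (z t) \<and> H1 (z t)) \<and>
        (\<forall>x is. length is \<le> 2 \<longrightarrow>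
           (\<forall>t. norm (iter_partial is (z t) x) \<le> C * exp (- \<gamma> * norm x))))"

end

theory Submission
  imports Defs
begin

text \<open>Along a decaying solution, mass, momentum and energy are conserved, the first moment satisfies
  \<open>d/dt \<integral> x\<^sub>j \<bar>u\<bar>\<^sup>2 = 2 P\<^sub>j\<close>, and the virial functional \<open>V = Im \<integral> cnj u (x \<cdot> \<nabla>u)\<close> satisfies
  \<open>V' = 2 (\<parallel>\<nabla>u\<parallel>\<^sup>2 - np / (2 (p + 2)) \<parallel>u\<parallel>\<^bsup>p+2\<^esup>)\<close>, the norm on the right being that of \<open>L\<^bsup>p+2\<^esup>\<close>.
  For a solution periodic in time, Rolle's theorem applied to the first moment gives
  a time at which \<open>P\<^sub>j\<close> vanishes, and applied to \<open>V\<close> a time at which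
  \<open>E = (np - 4) / (2 (p + 2)) \<parallel>u\<parallel>\<^bsup>p+2\<^esup>\<close>; by conservation both hold at all times.

  Nothing is known about the regularity of \<open>u\<^sub>t\<close>, so \<open>V\<close> and \<open>E\<close> are not differentiated under the
  integral. Being quadratic in \<open>(u, \<nabla>u)\<close>, the increments of \<open>V\<close> and of \<open>\<parallel>\<nabla>u\<parallel>\<^sup>2\<close> are instead
  rewritten by an integration by parts in space as a pairing of \<open>u(s) - u(t)\<close> with a function
  of \<open>u(s) + u(t)\<close>. In terms of the real inner product on the complex numbers,
  \<open>Re (cnj a b) = a \<bullet> b\<close> and \<open>Im (cnj a b) = \<i> a \<bullet> b\<close>.\<close>

section \<open>Partial derivatives along coordinate lines\<close>

text \<open>The hypotheses bound \<open>z\<close> up to second order, but of \<open>Q\<close> they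
  bound only the values. The radial equation supplies decay of the gradient of \<open>Q\<close>; no
  decay of its single second partials is ever established. The proof is therefore arranged so that,
  among second order quantities of \<open>u\<close>, only the Laplacian has to decay, which follows
  from the equation and the decay of \<open>ut\<close>. This is why integration by parts is stated
  for a whole divergence, and why the remaining second partials must cancel algebraically, through
  the symmetry of mixed partials. Momentum and virial functional are cases of one functional
  \<open>mom b c\<close> built on the vector field \<open>b + c x\<close>: translations for
  \<open>c = 0\<close>, dilations for \<open>b = 0\<close>, \<open>c = 1\<close>. One Pohozaev
  identity then yields both conservation of momentum and the virial law. Its multiplier is
  \<open>(b + c x) . grad u + (n c / 2) u\<close>, and the factor \<open>n p / (2 (p + 2))\<close>
  arises as \<open>n / 2 - n / (p + 2)\<close>.\<close>

definition has_partial :: "'n::finite \<Rightarrow> (real^'n \<Rightarrow> 'b::real_normed_vector) \<Rightarrow> (real^'n \<Rightarrow> 'b) \<Rightarrow> bool" where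
  "has_partial k f g \<longleftrightarrow>
     (\<forall>x. ((\<lambda>s. f (x + s *\<^sub>R axis k 1)) has_vector_derivative g x) (at 0))"

lemma has_partial_line:
  assumes "has_partial k f g"
  shows "((\<lambda>s. f (x + s *\<^sub>R axis k 1)) has_vector_derivative g (x + s *\<^sub>R axis k 1)) (at s within S)"
proof -
  have "((\<lambda>r. f ((x + s *\<^sub>R axis k 1) + r *\<^sub>R axis k 1)) has_vector_derivative g (x + s *\<^sub>R axis k 1)) (at (s - s))"
    using assms by (simp add: has_partial_def)
  then have "((\<lambda>r. f ((x + s *\<^sub>R axis k 1) + r *\<^sub>R axis k 1)) \<circ> (\<lambda>r. r - s) has_vector_derivative
      1 *\<^sub>R g (x + s *\<^sub>R axis k 1)) (at s)"
    by (intro vector_diff_chain_at) (auto intro!: derivative_eq_intros)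
  then have "((\<lambda>s. f (x + s *\<^sub>R axis k 1)) has_vector_derivative g (x + s *\<^sub>R axis k 1)) (at s)"
    by (simp add: o_def algebra_simps)
  then show ?thesis by (rule has_vector_derivative_at_within)
qed

text \<open>\<open>partial\<close> is read off the total derivative. Passing to the relation
  \<open>has_partial\<close> lets products, sums and powers be differentiated by one-variable rules,
  with no proof of their total differentiability.\<close>

lemma partial_has_partial:
  assumes "\<forall>x. f differentiable at x"
  shows "has_partial k f (partial k f)"
  unfolding has_partial_def
proof
  fix x
  have "(f has_derivative frechet_derivative f (at x)) (at x)"
    using assms frechet_derivative_works by blast
  then have 1: "(f has_derivative frechet_derivative f (at x)) (at (x + 0 *\<^sub>R axis k 1))"
    by simp
  have "((\<lambda>s. x + s *\<^sub>R axis k 1) has_derivative (\<lambda>s. s *\<^sub>R axis k 1)) (at 0)"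
    by (auto intro!: derivative_eq_intros)
  from has_derivative_compose[OF this 1]
  have "((\<lambda>s. f (x + s *\<^sub>R axis k 1)) has_derivative (\<lambda>s. frechet_derivative f (at x) (s *\<^sub>R axis k 1))) (at 0)" .
  moreover have "frechet_derivative f (at x) (s *\<^sub>R axis k 1) = s *\<^sub>R partial k f x" for s
    using linear_frechet_derivative[of f "at x"] assms
    by (simp add: partial_def linear_cmul)
  ultimately show "((\<lambda>s. f (x + s *\<^sub>R axis k 1)) has_vector_derivative partial k f x) (at 0)"
    by (simp add: has_vector_derivative_def)
qed

lemma has_partial_unique:
  assumes "has_partial k f g" "has_partial k f h"
  shows "g = h"
  using assms unfolding has_partial_def
  by (auto intro!: ext intro: vector_derivative_unique_at)

lemma has_partial_inner:
  fixes f :: "real^'n::finite \<Rightarrow> 'b::real_inner"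
  assumes "has_partial k f f'" "has_partial k g g'"
  shows "has_partial k (\<lambda>x. f x \<bullet> g x) (\<lambda>x. f x \<bullet> g' x + f' x \<bullet> g x)"
  unfolding has_partial_def
proof
  fix x
  have "((\<lambda>s. f (x + s *\<^sub>R axis k 1)) has_derivative (\<lambda>h. h *\<^sub>R f' x)) (at 0)"
    "((\<lambda>s. g (x + s *\<^sub>R axis k 1)) has_derivative (\<lambda>h. h *\<^sub>R g' x)) (at 0)"
    using assms by (auto simp: has_partial_def has_vector_derivative_def)
  from has_derivative_inner[OF this]
  show "((\<lambda>s. f (x + s *\<^sub>R axis k 1) \<bullet> g (x + s *\<^sub>R axis k 1)) has_vector_derivative
        f x \<bullet> g' x + f' x \<bullet> g x) (at 0)"
    by (simp add: has_vector_derivative_def algebra_simps)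
qed

lemma has_partial_const: "has_partial k (\<lambda>x. c) (\<lambda>x. 0)"
  by (simp add: has_partial_def)

lemma has_partial_add:
  "has_partial k f f' \<Longrightarrow> has_partial k g g' \<Longrightarrow> has_partial k (\<lambda>x. f x + g x) (\<lambda>x. f' x + g' x)"
  by (simp add: has_partial_def has_vector_derivative_add)

lemma has_partial_diff:
  "has_partial k f f' \<Longrightarrow> has_partial k g g' \<Longrightarrow> has_partial k (\<lambda>x. f x - g x) (\<lambda>x. f' x - g' x)"
  by (simp add: has_partial_def has_vector_derivative_diff)

lemma has_partial_sum:
  "(\<And>i. i \<in> I \<Longrightarrow> has_partial k (f i) (f' i)) \<Longrightarrow> has_partial k (\<lambda>x. \<Sum>i\<in>I. f i x) (\<lambda>x. \<Sum>i\<in>I. f' i x)"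
  by (simp add: has_partial_def has_vector_derivative_sum)

lemma has_partial_mult:
  fixes f g :: "real^'n::finite \<Rightarrow> real"
  shows "has_partial k f f' \<Longrightarrow> has_partial k g g' \<Longrightarrow> has_partial k (\<lambda>x. f x * g x) (\<lambda>x. f x * g' x + f' x * g x)"
  using has_partial_inner[of k f f' g g'] by simp

lemma has_partial_mult_left:
  fixes f :: "real^'n::finite \<Rightarrow> 'b::real_normed_algebra"
  shows "has_partial k f f' \<Longrightarrow> has_partial k (\<lambda>x. c * f x) (\<lambda>x. c * f' x)"
  by (simp add: has_partial_def has_vector_derivative_mult_right)

lemma has_partial_component: "has_partial k (\<lambda>x. x $ j) (\<lambda>x. if j = k then 1 else 0)"
  unfolding has_partial_def
  by (auto simp: axis_def has_real_derivative_iff_has_vector_derivative[symmetric] intro!: derivative_eq_intros)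

lemma has_partial_scale:
  assumes "has_partial k f f'"
  shows "has_partial k (\<lambda>x. f (r *\<^sub>R x)) (\<lambda>x. r *\<^sub>R f' (r *\<^sub>R x))"
  unfolding has_partial_def
proof
  fix x
  have "((\<lambda>s. f (r *\<^sub>R x + s *\<^sub>R axis k 1)) has_vector_derivative f' (r *\<^sub>R x)) (at (r * 0))"
    using assms by (simp add: has_partial_def)
  then have "((\<lambda>s. f (r *\<^sub>R x + s *\<^sub>R axis k 1)) \<circ> (\<lambda>s. r * s) has_vector_derivative r *\<^sub>R f' (r *\<^sub>R x)) (at 0)"
    by (intro vector_diff_chain_at) (auto intro!: derivative_eq_intros simp: has_real_derivative_iff_has_vector_derivative[symmetric])
  then show "((\<lambda>s. f (r *\<^sub>R (x + s *\<^sub>R axis k 1))) has_vector_derivative r *\<^sub>R f' (r *\<^sub>R x)) (at 0)"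
    by (simp add: o_def scaleR_right_distrib)
qed

lemma has_partial_of_real:
  "has_partial k f f' \<Longrightarrow> has_partial k (\<lambda>x. of_real (f x) :: complex) (\<lambda>x. of_real (f' x))"
  unfolding has_partial_def by (auto intro: bounded_linear.has_vector_derivative[OF bounded_linear_of_real])

text \<open>Two mean value theorems: in direction \<open>j\<close> for the increment of
  \<open>f\<close> by \<open>h\<close> along \<open>k\<close>, then in direction \<open>k\<close>
  for \<open>fj\<close>. The left side is symmetric in \<open>j\<close> and \<open>k\<close>, which
  is what makes it useful.\<close>

lemma second_difference_eq:
  fixes f :: "real^'n::finite \<Rightarrow> real"
  assumes f: "has_partial j f fj" "has_partial k fj fjk" and h: "0 < h"
  shows "\<exists>a. norm (a - x) \<le> 2 * h \<and>
    f (x + h *\<^sub>R axis j 1 + h *\<^sub>R axis k 1) - f (x + h *\<^sub>R axis j 1) - f (x + h *\<^sub>R axis k 1) + f x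
      = h\<^sup>2 * fjk a"
proof -
  let ?e = "axis j 1 :: real^'n" and ?d = "axis k 1 :: real^'n"
  define g where "g s = f ((x + h *\<^sub>R ?d) + s *\<^sub>R ?e) - f (x + s *\<^sub>R ?e)" for s
  have "(g has_real_derivative fj ((x + h *\<^sub>R ?d) + s *\<^sub>R ?e) - fj (x + s *\<^sub>R ?e)) (at s)" for s
    unfolding g_def has_real_derivative_iff_has_vector_derivative
    by (intro has_vector_derivative_diff has_partial_line f)
  then obtain s where s: "0 < s" "s < h"
      "g h - g 0 = (h - 0) * (fj ((x + h *\<^sub>R ?d) + s *\<^sub>R ?e) - fj (x + s *\<^sub>R ?e))"
    using MVT2[OF h, of g "\<lambda>s. fj ((x + h *\<^sub>R ?d) + s *\<^sub>R ?e) - fj (x + s *\<^sub>R ?e)"] by auto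
  have "((\<lambda>r. fj ((x + s *\<^sub>R ?e) + r *\<^sub>R ?d)) has_real_derivative fjk ((x + s *\<^sub>R ?e) + r *\<^sub>R ?d)) (at r)" for r
    unfolding has_real_derivative_iff_has_vector_derivative by (intro has_partial_line f)
  then obtain r where r: "0 < r" "r < h"
      "fj ((x + s *\<^sub>R ?e) + h *\<^sub>R ?d) - fj ((x + s *\<^sub>R ?e) + 0 *\<^sub>R ?d) = (h - 0) * fjk ((x + s *\<^sub>R ?e) + r *\<^sub>R ?d)"
    using MVT2[OF h, of "\<lambda>r. fj ((x + s *\<^sub>R ?e) + r *\<^sub>R ?d)" "\<lambda>r. fjk ((x + s *\<^sub>R ?e) + r *\<^sub>R ?d)"] by auto
  have "norm (((x + s *\<^sub>R ?e) + r *\<^sub>R ?d) - x) \<le> 2 * h"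
    using norm_triangle_ineq[of "s *\<^sub>R ?e" "r *\<^sub>R ?d"] s(1,2) r(1,2) by simp
  moreover have "g h - g 0 = h\<^sup>2 * fjk ((x + s *\<^sub>R ?e) + r *\<^sub>R ?d)"
    using s(3) r(3) by (simp add: power2_eq_square add_ac)
  ultimately show ?thesis
    by (intro exI[of _ "(x + s *\<^sub>R ?e) + r *\<^sub>R ?d"]) (simp add: g_def add_ac)
qed

text \<open>Both mixed partials represent the same second difference divided by
  \<open>h\<^sup>2\<close>, at points \<open>a\<close> and \<open>b\<close> within
  \<open>2 * h\<close> of \<open>x\<close>; continuity then rules out a gap at
  \<open>x\<close>.\<close>

lemma mixed_partials_commute_real:
  fixes f :: "real^'n::finite \<Rightarrow> real"
  assumes f: "has_partial j f fj" "has_partial k fj fjk" "has_partial k f fk" "has_partial j fk fkj"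
    and c: "continuous_on UNIV fjk" "continuous_on UNIV fkj"
  shows "fjk x = fkj x"
proof (rule ccontr)
  assume ne: "fjk x \<noteq> fkj x"
  define e where "e = \<bar>fjk x - fkj x\<bar> / 2"
  have e: "e > 0" using ne by (simp add: e_def)
  obtain d1 where d1: "d1 > 0" "\<And>a. dist a x < d1 \<Longrightarrow> dist (fjk a) (fjk x) < e"
    using c(1) e unfolding continuous_on_iff by (metis UNIV_I)
  obtain d2 where d2: "d2 > 0" "\<And>a. dist a x < d2 \<Longrightarrow> dist (fkj a) (fkj x) < e"
    using c(2) e unfolding continuous_on_iff by (metis UNIV_I)
  \<comment> \<open>The divisor 3 makes \<open>2 * h\<close> strictly smaller than both
    radii.\<close>
  define h where "h = min d1 d2 / 3"
  have h: "0 < h" using d1 d2 by (simp add: h_def)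
  obtain a where a: "norm (a - x) \<le> 2 * h"
    "f (x + h *\<^sub>R axis j 1 + h *\<^sub>R axis k 1) - f (x + h *\<^sub>R axis j 1) - f (x + h *\<^sub>R axis k 1) + f x = h\<^sup>2 * fjk a"
    using second_difference_eq[OF f(1,2) h] by blast
  obtain b where b: "norm (b - x) \<le> 2 * h"
    "f (x + h *\<^sub>R axis k 1 + h *\<^sub>R axis j 1) - f (x + h *\<^sub>R axis k 1) - f (x + h *\<^sub>R axis j 1) + f x = h\<^sup>2 * fkj b"
    using second_difference_eq[OF f(3,4) h] by blast
  have "x + h *\<^sub>R axis k 1 + h *\<^sub>R axis j 1 = x + h *\<^sub>R axis j 1 + h *\<^sub>R axis k 1"
    by (simp add: add_ac)
  then have "h\<^sup>2 * fjk a = h\<^sup>2 * fkj b" using a(2) b(2) by (smt (verit))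
  then have "fjk a = fkj b" using h by simp
  moreover have "dist a x < d1" "dist b x < d2"
    using a(1) b(1) d1(1) d2(1) by (auto simp: dist_norm h_def)
  ultimately show False using d1(2)[of a] d2(2)[of b]
    unfolding e_def dist_real_def by (simp add: field_simps abs_if split: if_splits)
qed

lemma mixed_partials_commute:
  fixes f :: "real^'n::finite \<Rightarrow> 'b::real_inner"
  assumes f: "has_partial j f fj" "has_partial k fj fjk" "has_partial k f fk" "has_partial j fk fkj"
    and c: "continuous_on UNIV fjk" "continuous_on UNIV fkj"
  shows "fjk x = fkj x"
proof -
  \<comment> \<open>Testing against the difference itself reduces the claim to real functions and
    leaves \<open>v \<bullet> v = 0\<close>.\<close>
  define v where "v = fjk x - fkj x"
  have p: "has_partial i (\<lambda>x. g x \<bullet> v) (\<lambda>x. g' x \<bullet> v)" if "has_partial i g g'" for i g g'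
    using has_partial_inner[OF that has_partial_const[of i v]] by simp
  have "fjk x \<bullet> v = fkj x \<bullet> v"
    by (rule mixed_partials_commute_real[OF f[THEN p]]) (intro continuous_intros c)+
  then have "v \<bullet> v = 0" by (simp add: v_def inner_diff_left)
  then show ?thesis by (simp add: v_def)
qed

lemma C_k_2_has_partials:
  assumes "C_k 2 f"
  shows "has_partial k f (partial k f)" "has_partial j (partial k f) (partial j (partial k f))"
    and "continuous_on UNIV f" "continuous_on UNIV (partial k f)" "continuous_on UNIV (partial j (partial k f))"
  using assms
  by (auto simp: numeral_2_eq_2 intro!: partial_has_partial continuous_at_imp_continuous_on differentiable_imp_continuous_within)

section \<open>Differentiating powers of the norm\<close>

lemma has_real_derivative_abs_powr:
  fixes q y :: real
  assumes q: "1 < q"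
  shows "((\<lambda>y. \<bar>y\<bar> powr q) has_real_derivative (if y \<ge> 0 then q * y powr (q - 1) else - q * (- y) powr (q - 1))) (at y)"
proof -
  consider "y > 0" | "y < 0" | "y = 0" by linarith
  then show ?thesis
  proof cases
    case 1
    have "((\<lambda>y. y powr q) has_real_derivative q * y powr (q - 1)) (at y)"
      using 1 by (auto intro!: derivative_eq_intros)
    moreover have "eventually (\<lambda>s::real. s > 0) (nhds y)" using 1 by (simp add: eventually_nhds_in_open[of "{0<..}", simplified])
    ultimately show ?thesis using 1
      by (subst DERIV_cong_ev[OF refl _ refl, where g = "\<lambda>y. y powr q"]) (auto elim: eventually_mono)
  next
    case 2
    have "((\<lambda>y. (- y) powr q) has_real_derivative - q * (- y) powr (q - 1)) (at y)"
      using 2 by (auto intro!: derivative_eq_intros)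
    moreover have "eventually (\<lambda>s::real. s < 0) (nhds y)" using 2 by (simp add: eventually_nhds_in_open[of "{..<0}", simplified])
    ultimately show ?thesis using 2
      by (subst DERIV_cong_ev[OF refl _ refl, where g = "\<lambda>y. (- y) powr q"]) (auto elim: eventually_mono)
  next
    case 3
    \<comment> \<open>At the origin the quotient has size \<open>\<bar>h\<bar> powr (q - 1)\<close>,
      which tends to 0 precisely because \<open>q\<close> exceeds 1.\<close>
    have "((\<lambda>h::real. \<bar>h\<bar> powr q / h) \<longlongrightarrow> 0) (at 0)"
    proof (rule Lim_null_comparison)
      show "\<forall>\<^sub>F h::real in at 0. norm (\<bar>h\<bar> powr q / h) \<le> \<bar>h\<bar> powr (q - 1)"
        unfolding eventually_at by (rule exI[of _ 1]) (auto simp: powr_diff)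
      have "((\<lambda>h::real. \<bar>h\<bar> powr (q - 1)) \<longlongrightarrow> \<bar>0\<bar> powr (q - 1)) (at 0)"
        using q by (intro tendsto_powr' tendsto_intros) auto
      then show "((\<lambda>h::real. \<bar>h\<bar> powr (q - 1)) \<longlongrightarrow> 0) (at 0)" by simp
    qed
    then show ?thesis using 3 by (simp add: DERIV_def)
  qed
qed

text \<open>Zeros of \<open>w\<close> are harmless once the power is written as
  \<open>(w \<bullet> w) powr (p / 2 + 1)\<close>: the inner product is smooth, unlike the norm, and
  \<open>p > 0\<close> pushes the exponent above 1.\<close>

lemma has_real_derivative_norm_powr:
  fixes w :: "real \<Rightarrow> 'b::real_inner"
  assumes w: "(w has_vector_derivative w') (at s)" and p: "0 < p"
  shows "((\<lambda>s. norm (w s) powr (p + 2)) has_real_derivative (p + 2) * norm (w s) powr p * (w s \<bullet> w')) (at s)"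
proof -
  have *: "norm v powr (p + 2) = \<bar>v \<bullet> v\<bar> powr (p / 2 + 1)" for v :: 'b
  proof -
    have "norm v powr (p + 2) = (norm v powr 2) powr (p / 2 + 1)"
      unfolding powr_powr by (rule arg_cong) simp
    then show ?thesis by (simp add: power2_norm_eq_inner)
  qed
  have **: "(v \<bullet> v) powr (p / 2) = norm v powr p" for v :: 'b
  proof -
    have "norm v powr p = (norm v powr 2) powr (p / 2)"
      unfolding powr_powr by simp
    then show ?thesis by (simp add: power2_norm_eq_inner)
  qed
  have "((\<lambda>s. w s \<bullet> w s) has_derivative (\<lambda>h. w s \<bullet> (h *\<^sub>R w') + (h *\<^sub>R w') \<bullet> w s)) (at s)"
    using w unfolding has_vector_derivative_def by (intro has_derivative_inner)
  then have d: "((\<lambda>s. w s \<bullet> w s) has_real_derivative 2 * (w s \<bullet> w')) (at s)"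
    by (simp add: has_field_derivative_def mult_commute_abs inner_commute algebra_simps)
  from DERIV_chain2[OF has_real_derivative_abs_powr[of "p / 2 + 1"] d] p
  show ?thesis unfolding * by (simp add: ** algebra_simps)
qed

lemma has_partial_norm_powr:
  fixes f :: "real^'n::finite \<Rightarrow> 'b::real_inner"
  assumes "has_partial k f f'" "0 < p"
  shows "has_partial k (\<lambda>x. norm (f x) powr (p + 2)) (\<lambda>x. (p + 2) * norm (f x) powr p * (f x \<bullet> f' x))"
  unfolding has_partial_def
proof
  fix x
  have "((\<lambda>s. f (x + s *\<^sub>R axis k 1)) has_vector_derivative f' x) (at 0)"
    using assms by (simp add: has_partial_def)
  from has_real_derivative_norm_powr[OF this assms(2)]
  show "((\<lambda>s. norm (f (x + s *\<^sub>R axis k 1)) powr (p + 2)) has_vector_derivative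
        (p + 2) * norm (f x) powr p * (f x \<bullet> f' x)) (at 0)"
    by (simp add: has_real_derivative_iff_has_vector_derivative)
qed

text \<open>Convergence of values upgrades to convergence of derivatives because the second
  derivatives are uniformly bounded: compare \<open>z'\<close> with a difference quotient of small step.\<close>

lemma partial_tendsto:
  fixes z :: "real \<Rightarrow> real^'n::finite \<Rightarrow> complex"
  assumes z: "\<And>x. ((\<lambda>s. z s x) \<longlongrightarrow> z t x) (at t)"
    and z': "\<And>s. has_partial k (z s) (z' s)" and z'': "\<And>s. has_partial k (z' s) (z'' s)"
    and M: "\<And>s x. norm (z'' s x) \<le> M"
  shows "((\<lambda>s. z' s x) \<longlongrightarrow> z' t x) (at t)"
proof (rule LIM_zero_cancel, rule tendstoI)
  fix \<epsilon> :: real assume \<epsilon>: "0 < \<epsilon>"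
  have M0: "0 \<le> M" using order_trans[OF norm_ge_zero M] .
  \<comment> \<open>The step leaves a Taylor error \<open>2 * M * h\<close> below
    \<open>\<epsilon> / 2\<close>; the summand 4 keeps the denominator positive when
    \<open>M = 0\<close>.\<close>
  define h where "h = \<epsilon> / (4 * M + 4)"
  have h: "0 < h" "2 * M * h < \<epsilon> / 2" using \<epsilon> M0 by (auto simp: h_def field_simps)
  let ?e = "axis k 1 :: real^'n"
  have key: "norm (z' s x - z' t x) \<le> norm ((z s (x + h *\<^sub>R ?e) - z t (x + h *\<^sub>R ?e)) - (z s x - z t x)) / h + 2 * M * h" for s
  proof -
    define f where "f r = z s (x + r *\<^sub>R ?e) - z t (x + r *\<^sub>R ?e)" for r
    define f1 where "f1 r = z' s (x + r *\<^sub>R ?e) - z' t (x + r *\<^sub>R ?e)" for r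
    define f2 where "f2 r = z'' s (x + r *\<^sub>R ?e) - z'' t (x + r *\<^sub>R ?e)" for r
    have df: "(f has_vector_derivative f1 r) (at r within S)" for r S
      unfolding f_def f1_def by (intro has_vector_derivative_diff has_partial_line z')
    have df1: "(f1 has_vector_derivative f2 r) (at r within S)" for r S
      unfolding f1_def f2_def by (intro has_vector_derivative_diff has_partial_line z'')
    have f2: "norm (f2 r) \<le> 2 * M" for r
      unfolding f2_def using norm_triangle_ineq4[of "z'' s (x + r *\<^sub>R ?e)" "z'' t (x + r *\<^sub>R ?e)"]
        M[of s "x + r *\<^sub>R ?e"] M[of t "x + r *\<^sub>R ?e"] by linarith
    have b1: "norm (f1 r - f1 0) \<le> 2 * M * h" if r: "r \<in> {0..h}" for r
    proof -
      have "norm (f1 r - f1 0) \<le> (2 * M) * norm (r - 0)"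
      proof (rule differentiable_bound[where S = UNIV and f' = "\<lambda>r h. h *\<^sub>R f2 r"])
        show "(f1 has_derivative (\<lambda>h. h *\<^sub>R f2 r)) (at r within UNIV)" for r
          using df1 by (simp add: has_vector_derivative_def)
        show "onorm (\<lambda>h. h *\<^sub>R f2 r) \<le> 2 * M" for r
          using f2[of r] M0 by (intro onorm_bound) (auto simp: mult.commute[of "2 * M"] intro!: mult_left_mono)
      qed auto
      also have "\<dots> \<le> 2 * M * h" using r M0 by (intro mult_left_mono) auto
      finally show ?thesis .
    qed
    \<comment> \<open>With the linear part removed, the derivative \<open>f1 r - f1 0\<close> is at
      most \<open>2 * M * h\<close> on \<open>{0..h}\<close>, so the mean value inequality bounds
      the distance of the difference quotient from \<open>f1 0\<close>.\<close>
    define g where "g r = f r - r *\<^sub>R f1 0" for r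
    have "norm (g h - g 0) \<le> (2 * M * h) * norm (h - 0)"
    proof (rule differentiable_bound[where S = "{0..h}" and f' = "\<lambda>r h. h *\<^sub>R (f1 r - f1 0)"])
      show "(g has_derivative (\<lambda>h. h *\<^sub>R (f1 r - f1 0))) (at r within {0..h})" for r
      proof -
        have "(g has_vector_derivative f1 r - 1 *\<^sub>R f1 0) (at r within {0..h})"
          unfolding g_def by (intro has_vector_derivative_diff df) (auto intro!: derivative_eq_intros)
        then show ?thesis by (simp add: has_vector_derivative_def)
      qed
      show "onorm (\<lambda>q. q *\<^sub>R (f1 r - f1 0)) \<le> 2 * M * h" if "r \<in> {0..h}" for r
        using b1[OF that] M0 h(1)
        by (intro onorm_bound) (auto simp: mult.commute[of "2 * M * h"] intro!: mult_left_mono)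
    qed (use h in auto)
    then have *: "norm ((f h - f 0) - h *\<^sub>R f1 0) \<le> 2 * M * h * h" using h by (simp add: g_def algebra_simps)
    have "norm (h *\<^sub>R f1 0) \<le> norm (f h - f 0) + norm ((f h - f 0) - h *\<^sub>R f1 0)"
      using norm_triangle_ineq4[of "f h - f 0" "(f h - f 0) - h *\<^sub>R f1 0"] by simp
    then have "h * norm (f1 0) \<le> norm (f h - f 0) + 2 * M * h * h" using * h by simp
    then have "norm (f1 0) \<le> (norm (f h - f 0) + 2 * M * h * h) / h" using h by (simp add: field_simps)
    also have "\<dots> = norm (f h - f 0) / h + 2 * M * h" using h by (simp add: field_simps)
    finally show ?thesis by (simp add: f_def f1_def)
  qed
  have "((\<lambda>s. norm ((z s (x + h *\<^sub>R ?e) - z t (x + h *\<^sub>R ?e)) - (z s x - z t x)) / h)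
      \<longlongrightarrow> norm ((z t (x + h *\<^sub>R ?e) - z t (x + h *\<^sub>R ?e)) - (z t x - z t x)) / h) (at t)"
    using h by (intro tendsto_intros z) auto
  then have "((\<lambda>s. norm ((z s (x + h *\<^sub>R ?e) - z t (x + h *\<^sub>R ?e)) - (z s x - z t x)) / h) \<longlongrightarrow> 0) (at t)"
    by simp
  then have "\<forall>\<^sub>F s in at t. norm ((z s (x + h *\<^sub>R ?e) - z t (x + h *\<^sub>R ?e)) - (z s x - z t x)) / h < \<epsilon> / 2"
    using \<epsilon> by (intro order_tendstoD(2)) auto
  then show "\<forall>\<^sub>F s in at t. dist (z' s x - z' t x) 0 < \<epsilon>"
  proof (rule eventually_mono)
    fix s
    assume "norm ((z s (x + h *\<^sub>R ?e) - z t (x + h *\<^sub>R ?e)) - (z s x - z t x)) / h < \<epsilon> / 2"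
    then show "dist (z' s x - z' t x) 0 < \<epsilon>"
      using key[of s] h(2) unfolding dist_norm diff_0_right by linarith
  qed
qed

section \<open>Integration over the whole space\<close>

lemma has_real_derivative_norm_sq_line:
  "((\<lambda>s. (x + s *\<^sub>R axis k 1) \<bullet> (x + s *\<^sub>R axis k (1::real))) has_real_derivative 2 * x $ k) (at 0)"
  by (auto intro!: derivative_eq_intros simp: inner_add_left inner_add_right inner_axis inner_axis')

lemma tendsto_integral_at:
  fixes s :: "real \<Rightarrow> 'a \<Rightarrow> 'b::{banach, second_countable_topology}"
  assumes "\<And>h. s h \<in> borel_measurable M" "f \<in> borel_measurable M" "integrable M w"
    and "\<And>x. ((\<lambda>h. s h x) \<longlongrightarrow> f x) (at t)"
    and "\<And>h x. h \<noteq> t \<Longrightarrow> norm (s h x) \<le> w x"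
  shows "((\<lambda>h. LINT x|M. s h x) \<longlongrightarrow> (LINT x|M. f x)) (at t)"
  unfolding tendsto_at_iff_sequentially
proof (intro allI impI)
  fix X :: "nat \<Rightarrow> real"
  assume X: "\<forall>i. X i \<in> UNIV - {t}" "X \<longlonglongrightarrow> t"
  have "(\<lambda>i. LINT x|M. s (X i) x) \<longlonglongrightarrow> (LINT x|M. f x)"
  proof (rule integral_dominated_convergence[where w = w])
    show "AE x in M. (\<lambda>i. s (X i) x) \<longlonglongrightarrow> f x"
      using assms(4) X unfolding tendsto_at_iff_sequentially by (auto simp: o_def)
    show "AE x in M. norm (s (X i) x) \<le> w x" for i
      using assms(5) X by auto
  qed (use assms in auto)
  then show "((\<lambda>h. LINT x|M. s h x) \<circ> X) \<longlonglongrightarrow> (LINT x|M. f x)"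
    by (simp add: o_def)
qed

section \<open>Integrability of exponentially decaying weights\<close>

lemma power_le_exp:
  assumes "0 < c"
  shows "\<exists>B. \<forall>y::real\<ge>0. y ^ d \<le> B * exp (c * y)"
proof (cases "d = 0")
  case True
  then show ?thesis using assms by (intro exI[of _ 1]) (simp add: mult_nonneg_nonneg)
next
  case False
  \<comment> \<open>The constant comes from raising \<open>t \<le> exp t\<close> at
    \<open>t = c * y / d\<close> to the power \<open>d\<close>; this division is why
    \<open>d = 0\<close> was split off.\<close>
  have "y ^ d \<le> (d / c) ^ d * exp (c * y)" if "y \<ge> 0" for y :: real
  proof -
    have "c * y / d \<le> exp (c * y / d)"
      using exp_ge_add_one_self[of "c * y / d"] by linarith
    then have "(c * y / d) ^ d \<le> exp (c * y / d) ^ d"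
      using that assms by (intro power_mono) auto
    also have "\<dots> = exp (c * y)"
      using False by (simp add: exp_of_nat_mult[symmetric])
    finally have "(d / c) ^ d * (c * y / d) ^ d \<le> (d / c) ^ d * exp (c * y)"
      using assms by (intro mult_left_mono) auto
    also have "(d / c) ^ d * (c * y / d) ^ d = y ^ d"
      using assms False by (simp add: power_mult_distrib[symmetric])
    finally show ?thesis .
  qed
  then show ?thesis by blast
qed

text \<open>The function lies below the sum over \<open>k\<close> of \<open>exp (- c * k)\<close> on
  the ball of radius \<open>k + 1\<close>: the term with \<open>k\<close> the integer part of
  \<open>norm x\<close> already suffices. Ball volumes grow polynomially, and half of the rate
  \<open>c\<close> absorbs that growth, leaving a geometric series.\<close>

lemma integrable_exp_neg_norm:
  assumes "0 < c"
  shows "integrable lborel (\<lambda>x::'a::euclidean_space. exp (- c * norm x))"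
proof -
  let ?d = "DIM('a)"
  let ?b = "\<lambda>k::nat. exp (- c * k) * (unit_ball_vol ?d * (real k + 1) ^ ?d)"
  obtain B where B: "\<And>y. y \<ge> 0 \<Longrightarrow> y ^ ?d \<le> B * exp (c / 2 * y)"
    using power_le_exp[of "c / 2" ?d] assms by auto
  have sm: "summable ?b"
  proof (rule summable_comparison_test')
    have "norm (exp (- c / 2)) < 1" using assms by simp
    then show "summable (\<lambda>k. unit_ball_vol ?d * B * exp (c / 2) * exp (- c / 2) ^ k)"
      by (intro summable_mult summable_geometric)
    show "norm (?b k) \<le> unit_ball_vol ?d * B * exp (c / 2) * exp (- c / 2) ^ k" for k
    proof -
      have "norm (?b k) = unit_ball_vol ?d * exp (- c * k) * (real k + 1) ^ ?d"
        by (simp add: abs_mult unit_ball_vol_nonneg)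
      also have "\<dots> \<le> unit_ball_vol ?d * exp (- c * k) * (B * exp (c / 2 * (real k + 1)))"
        by (intro mult_left_mono B) (auto simp: unit_ball_vol_nonneg)
      also have "\<dots> = unit_ball_vol ?d * B * exp (c / 2) * exp (- c / 2) ^ k"
        by (simp add: exp_of_nat_mult[symmetric] mult_exp_exp field_simps)
      finally show ?thesis .
    qed
  qed
  have "(\<integral>\<^sup>+x. ennreal (exp (- c * norm (x::'a))) \<partial>lborel)
      \<le> (\<integral>\<^sup>+x. (\<Sum>k. ennreal (exp (- c * k)) * indicator (ball (0::'a) (real k + 1)) x) \<partial>lborel)"
  proof (intro nn_integral_mono)
    fix x :: 'a
    define k where "k = nat \<lfloor>norm x\<rfloor>"
    have k: "real k \<le> norm x" "norm x < real k + 1" by (auto simp: k_def)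
    have "ennreal (exp (- c * norm x)) \<le> ennreal (exp (- c * k)) * indicator (ball (0::'a) (real k + 1)) x"
      using k assms by (auto simp: ennreal_leI)
    also have "\<dots> \<le> (\<Sum>k. ennreal (exp (- c * k)) * indicator (ball (0::'a) (real k + 1)) x)"
    proof -
      have "sum f {k} \<le> suminf f" for f :: "nat \<Rightarrow> ennreal"
        by (intro sum_le_suminf) auto
      from this[of "\<lambda>k. ennreal (exp (- c * k)) * indicator (ball (0::'a) (real k + 1)) x"]
      show ?thesis by (simp only: sum.insert finite.emptyI empty_iff sum.empty add_0_right simp_thms)
    qed
    finally show "ennreal (exp (- c * norm x)) \<le> \<dots>" .
  qed
  also have "\<dots> = (\<Sum>k. ennreal (exp (- c * k)) * emeasure lborel (ball (0::'a) (real k + 1)))"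
  proof -
    have [measurable]: "ball (0::'a) (real k + 1) \<in> sets borel" for k by simp
    show ?thesis
      by (subst nn_integral_suminf) (measurable, subst nn_integral_cmult_indicator, simp_all)
  qed
  also have "\<dots> = (\<Sum>k. ennreal (?b k))"
    by (subst emeasure_ball) (auto simp: ennreal_mult[symmetric] unit_ball_vol_nonneg)
  also have "\<dots> < \<infinity>"
    by (subst suminf_ennreal2[OF _ sm]) (simp_all add: unit_ball_vol_nonneg)
  finally show ?thesis
    by (intro integrableI_bounded) auto
qed

text \<open>The linear factor accommodates the weight \<open>x\<close> of the first moment and of
  the virial functional; half of the decay rate pays for it.\<close>

lemma integrable_weight:
  assumes "0 < c"
  shows "integrable lborel (\<lambda>x::'a::euclidean_space. (1 + norm x) * exp (- c * norm x))"
proof (rule Bochner_Integration.integrable_bound)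
  show "integrable lborel (\<lambda>x::'a. (1 + 2 / c) * exp (- (c / 2) * norm x))"
    using assms by (intro integrable_mult_right integrable_exp_neg_norm) auto
  show "AE x::'a in lborel. norm ((1 + norm x) * exp (- c * norm x))
      \<le> norm ((1 + 2 / c) * exp (- (c / 2) * norm x))"
  proof (rule AE_I2)
    fix x :: 'a
    have "c / 2 * norm x \<le> exp (c / 2 * norm x)"
      using exp_ge_add_one_self[of "c / 2 * norm x"] by linarith
    moreover have "1 \<le> exp (c / 2 * norm x)"
      using assms by simp
    ultimately have "1 + 2 / c * (c / 2 * norm x) \<le> exp (c / 2 * norm x) + 2 / c * exp (c / 2 * norm x)"
      using assms by (intro add_mono mult_left_mono) auto
    then have "1 + norm x \<le> (1 + 2 / c) * exp (c / 2 * norm x)"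
      using assms by (simp add: algebra_simps)
    then have "(1 + norm x) * exp (- c * norm x) \<le> (1 + 2 / c) * exp (c / 2 * norm x) * exp (- c * norm x)"
      by (intro mult_right_mono) auto
    also have "\<dots> = (1 + 2 / c) * exp (- (c / 2) * norm x)"
      by (simp add: mult_exp_exp)
    finally show "norm ((1 + norm x) * exp (- c * norm x))
        \<le> norm ((1 + 2 / c) * exp (- (c / 2) * norm x))"
      using assms by (auto simp: abs_mult)
  qed
qed auto

lemma integrable_of_weight_bound:
  fixes f :: "'a::euclidean_space \<Rightarrow> 'b::{banach, second_countable_topology}"
  assumes "continuous_on UNIV f" "0 < c"
    and "\<And>x. norm (f x) \<le> K * ((1 + norm x) * exp (- c * norm x))"
  shows "integrable lborel f"
proof (rule Bochner_Integration.integrable_bound)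
  show "integrable lborel (\<lambda>x::'a. K * ((1 + norm x) * exp (- c * norm x)))"
    by (intro integrable_mult_right integrable_weight assms)
  show "f \<in> borel_measurable lborel"
    using borel_measurable_continuous_onI[OF assms(1)] by simp
  show "AE x in lborel. norm (f x) \<le> norm (K * ((1 + norm x) * exp (- c * norm x)))"
    using assms(3) by (auto intro!: AE_I2 order_trans[OF _ abs_ge_self])
qed

text \<open>By translation invariance of Lebesgue measure every difference quotient of
  \<open>f\<close> has integral 0; dominated convergence passes this on to the derivative, without
  iterated integrals.\<close>

lemma integral_partial_eq_0_of_bounded_support:
  fixes f g :: "real^'n::finite \<Rightarrow> real"
  assumes fg: "has_partial k f g" and cont: "continuous_on UNIV f" "continuous_on UNIV g"
    and supp: "\<And>x. norm x > R \<Longrightarrow> f x = 0"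
  shows "(LINT x|lborel. g x) = 0"
proof -
  define e where "e = (axis k 1 :: real^'n)"
  have e: "norm e = 1" by (simp add: e_def)
  define h where "h m = inverse (real (Suc m))" for m
  have h: "0 < h m" "h m \<le> 1" for m by (auto simp: h_def field_simps)
  have h0: "h \<longlonglongrightarrow> 0" unfolding h_def by (rule LIMSEQ_inverse_real_of_nat)
  have "bounded (g ` cball 0 (R + 2))"
    by (intro compact_imp_bounded compact_continuous_image continuous_on_subset[OF cont(2)]) auto
  then obtain G where G: "\<And>x. norm x \<le> R + 2 \<Longrightarrow> \<bar>g x\<bar> \<le> G"
    unfolding bounded_iff by fastforce
  \<comment> \<open>Since \<open>h m \<le> 1\<close>, the quotient vanishes outside radius
    \<open>R + 1\<close>, and mean value points for \<open>x\<close> inside that ball stay within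
    \<open>R + 2\<close>, where \<open>G\<close> bounds \<open>g\<close>.\<close>
  let ?w = "\<lambda>x. G * indicator (cball (0::real^'n) (R + 1)) x"
  have fint: "integrable lborel f"
  proof -
    have "integrable lborel (\<lambda>x. indicator (cball 0 R) x *\<^sub>R f x)"
      by (rule borel_integrable_compact) (auto intro: continuous_on_subset[OF cont(1)])
    moreover have "(\<lambda>x. indicator (cball 0 R) x *\<^sub>R f x) = f"
      using supp by (auto simp: indicator_def fun_eq_iff)
    ultimately show ?thesis by simp
  qed
  have shift: "integrable lborel (\<lambda>x. f (x + a))" "(LINT x|lborel. f (x + a)) = (LINT x|lborel. f x)" for a
  proof -
    have m: "f \<in> borel_measurable borel" using cont(1) by (rule borel_measurable_continuous_onI)
    have "integrable (distr lborel borel ((+) a)) f" using fint by (simp add: lborel_distr_plus)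
    then show "integrable lborel (\<lambda>x. f (x + a))"
      using m by (subst (asm) integrable_distr_eq) (auto simp: add.commute)
    have "(LINT x|lborel. f x) = (LINT x|distr lborel borel ((+) a). f x)" by (simp add: lborel_distr_plus)
    also have "\<dots> = (LINT x|lborel. f (x + a))"
      using m by (subst integral_distr) (auto simp: add.commute)
    finally show "(LINT x|lborel. f (x + a)) = (LINT x|lborel. f x)" by simp
  qed
  have q: "(LINT x|lborel. (f (x + h m *\<^sub>R e) - f x) / h m) = 0" for m
    using shift fint by simp
  have "(\<lambda>m. LINT x|lborel. (f (x + h m *\<^sub>R e) - f x) / h m) \<longlonglongrightarrow> (LINT x|lborel. g x)"
  proof (rule integral_dominated_convergence[where w = ?w])
    show "g \<in> borel_measurable lborel"
      using borel_measurable_continuous_onI[OF cont(2)] by simp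
    show "(\<lambda>x. (f (x + h m *\<^sub>R e) - f x) / h m) \<in> borel_measurable lborel" for m
      using shift fint by (intro borel_measurable_integrable) auto
    show "integrable lborel ?w"
      by (intro integrable_mult_right integrable_real_indicator emeasure_bounded_finite) auto
    show "AE x in lborel. (\<lambda>m. (f (x + h m *\<^sub>R e) - f x) / h m) \<longlonglongrightarrow> g x"
    proof (rule AE_I2)
      fix x
      have "((\<lambda>s. f (x + s *\<^sub>R e)) has_real_derivative g x) (at 0)"
        using fg by (simp add: has_partial_def e_def has_real_derivative_iff_has_vector_derivative)
      then have "((\<lambda>s. (f (x + s *\<^sub>R e) - f x) / s) \<longlongrightarrow> g x) (at 0)"
        by (simp add: DERIV_def)
      then show "(\<lambda>m. (f (x + h m *\<^sub>R e) - f x) / h m) \<longlonglongrightarrow> g x"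
        by (rule filterlim_compose) (use h0 h(1) in \<open>simp add: filterlim_at less_imp_neq[THEN not_sym]\<close>)
    qed
    show "AE x in lborel. norm ((f (x + h m *\<^sub>R e) - f x) / h m) \<le> ?w x" for m
    proof (rule AE_I2)
      fix x
      show "norm ((f (x + h m *\<^sub>R e) - f x) / h m) \<le> ?w x"
      proof (cases "norm x \<le> R + 1")
        case True
        have "\<exists>z. 0 < z \<and> z < h m \<and> f (x + h m *\<^sub>R e) - f (x + 0 *\<^sub>R e) = (h m - 0) * g (x + z *\<^sub>R e)"
          using has_partial_line[OF fg, of x]
          by (intro MVT2 h) (auto simp: has_real_derivative_iff_has_vector_derivative e_def)
        then obtain z where z: "0 < z" "z < h m" "f (x + h m *\<^sub>R e) - f x = h m * g (x + z *\<^sub>R e)"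
          by auto
        have "norm (x + z *\<^sub>R e) \<le> R + 2"
          using norm_triangle_ineq[of x "z *\<^sub>R e"] True z(1,2) h(2)[of m] e by simp
        then show ?thesis using G True h(1)[of m] z(3) by simp
      next
        case False
        have "norm x \<le> norm (x + h m *\<^sub>R e) + norm (h m *\<^sub>R e)"
          using norm_triangle_ineq4[of "x + h m *\<^sub>R e" "h m *\<^sub>R e"] by simp
        then have "norm (x + h m *\<^sub>R e) > R" using False e h[of m] by simp
        then show ?thesis using supp False by simp
      qed
    qed
  qed
  then show ?thesis unfolding q by (simp add: LIMSEQ_const_iff)
qed

text \<open>Squaring removes the corner of the positive part, so the cutoffs built from it have
  continuous partial derivatives.\<close>

lemma has_real_derivative_pos_part_sq:
  "((\<lambda>s::real. (max 0 s)\<^sup>2) has_real_derivative 2 * max 0 s) (at s)"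
proof -
  consider "s > 0" | "s < 0" | "s = 0" by linarith
  then show ?thesis
  proof cases
    case 1
    have "((\<lambda>s::real. s\<^sup>2) has_real_derivative 2 * s) (at s)" by (auto intro!: derivative_eq_intros)
    moreover have "eventually (\<lambda>s::real. s > 0) (nhds s)" using 1 by (simp add: eventually_nhds_in_open[of "{0<..}", simplified])
    ultimately show ?thesis using 1
      by (subst DERIV_cong_ev[OF refl _ refl, where g = "\<lambda>s. s\<^sup>2"]) (auto elim: eventually_mono)
  next
    case 2
    moreover have "eventually (\<lambda>s::real. s < 0) (nhds s)" using 2 by (simp add: eventually_nhds_in_open[of "{..<0}", simplified])
    ultimately show ?thesis
      by (subst DERIV_cong_ev[OF refl _ refl, where g = "\<lambda>s. 0"]) (auto elim: eventually_mono)
  next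
    case 3
    have "((\<lambda>h::real. (max 0 h)\<^sup>2 / h) \<longlongrightarrow> 0) (at 0)"
    proof (rule Lim_null_comparison)
      show "\<forall>\<^sub>F h::real in at 0. norm ((max 0 h)\<^sup>2 / h) \<le> \<bar>h\<bar>"
        by (auto intro!: always_eventually simp: max_def power2_eq_square)
      show "((\<lambda>h::real. \<bar>h\<bar>) \<longlongrightarrow> 0) (at 0)" by (auto intro!: tendsto_eq_intros)
    qed
    then show ?thesis using 3 by (simp add: DERIV_def)
  qed
qed

text \<open>Only the divergence has to be integrable, not each \<open>G k\<close>: for the ground state decay is available for
  the Laplacian but not for the individual second derivatives. Hence the cutoffs in the proof.\<close>

lemma integral_divergence_eq_0:
  fixes F G :: "'n::finite \<Rightarrow> real^'n \<Rightarrow> real"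
  assumes FG: "\<And>k. has_partial k (F k) (G k)"
    and cont: "\<And>k. continuous_on UNIV (F k)" "\<And>k. continuous_on UNIV (G k)"
    and int: "\<And>k. integrable lborel (F k)" "integrable lborel (\<lambda>x. \<Sum>k\<in>UNIV. G k x)"
  shows "(LINT x|lborel. (\<Sum>k\<in>UNIV. G k x)) = 0"
proof -
  define r where "r m = real (Suc m)" for m
  have r: "r m \<ge> 1" for m by (simp add: r_def)
  \<comment> \<open>A cutoff vanishing outside the ball of radius \<open>r m\<close>, tending to 1
    pointwise, with partials at most \<open>4 / r m\<close>: the last property kills the terms
    containing \<open>F\<close>.\<close>
  define c where "c m x = (max 0 (1 - (x \<bullet> x) / (r m)\<^sup>2))\<^sup>2" for m and x :: "real^'n"
  define d where "d m k x = 2 * max 0 (1 - (x \<bullet> x) / (r m)\<^sup>2) * (- 2 * x $ k / (r m)\<^sup>2)" for m k and x :: "real^'n"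
  have cd: "has_partial k (c m) (d m k)" for m k
    unfolding has_partial_def
  proof
    fix x :: "real^'n"
    from DERIV_diff[OF DERIV_const[of 1] DERIV_cdivide[OF has_real_derivative_norm_sq_line, where c = "(r m)\<^sup>2"]]
    have "((\<lambda>s. 1 - ((x + s *\<^sub>R axis k 1) \<bullet> (x + s *\<^sub>R axis k 1)) / (r m)\<^sup>2) has_real_derivative - 2 * x $ k / (r m)\<^sup>2) (at 0)"
      by simp
    from DERIV_chain2[OF has_real_derivative_pos_part_sq this]
    show "((\<lambda>s. c m (x + s *\<^sub>R axis k 1)) has_vector_derivative d m k x) (at 0)"
      by (simp add: c_def d_def has_real_derivative_iff_has_vector_derivative)
  qed
  have c_cont: "continuous_on UNIV (c m)" "continuous_on UNIV (d m k)" for m k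
    unfolding c_def d_def by (intro continuous_intros; simp add: r_def)+
  have m_le: "max 0 (1 - (x \<bullet> x) / (r m)\<^sup>2) \<le> 1" for m and x :: "real^'n" by simp
  have c_le: "0 \<le> c m x" "c m x \<le> 1" for m x
    unfolding c_def using m_le by (auto intro!: power_le_one)
  have zero: "max 0 (1 - (x \<bullet> x) / (r m)\<^sup>2) = 0" if "norm x > r m" for m and x :: "real^'n"
  proof -
    have "(r m)\<^sup>2 \<le> (norm x)\<^sup>2" using that r[of m] by (intro power_mono) auto
    then show ?thesis using r[of m] by (simp add: power2_norm_eq_inner field_simps)
  qed
  have d_le: "\<bar>d m k x\<bar> \<le> 4 / r m" for m k x
  proof (cases "norm x > r m")
    case True then show ?thesis using zero[OF True] r[of m] by (simp add: d_def)
  next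
    case False
    then have xk: "\<bar>x $ k\<bar> \<le> r m" using component_le_norm_cart[of x k] by linarith
    have "\<bar>d m k x\<bar> = max 0 (1 - (x \<bullet> x) / (r m)\<^sup>2) * (4 * \<bar>x $ k\<bar> / (r m)\<^sup>2)"
      by (simp add: d_def abs_mult)
    also have "\<dots> \<le> 1 * (4 * r m / (r m)\<^sup>2)"
      using xk by (intro mult_mono m_le divide_right_mono) simp_all
    also have "\<dots> = 4 / r m" by (simp add: power2_eq_square)
    finally show ?thesis .
  qed
  have cF: "(LINT x|lborel. c m x * G k x + d m k x * F k x) = 0" for m k
  proof (rule integral_partial_eq_0_of_bounded_support[where f = "\<lambda>x. c m x * F k x" and k = k and R = "r m"])
    show "has_partial k (\<lambda>x. c m x * F k x) (\<lambda>x. c m x * G k x + d m k x * F k x)"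
      unfolding has_partial_def
    proof
      fix x
      show "((\<lambda>s. c m (x + s *\<^sub>R axis k 1) * F k (x + s *\<^sub>R axis k 1)) has_vector_derivative
          c m x * G k x + d m k x * F k x) (at 0)"
        using has_vector_derivative_mult[OF has_partial_line[OF cd[of k m], of x 0 UNIV] has_partial_line[OF FG[of k], of x 0 UNIV]]
        by simp
    qed
    show "c m x * F k x = 0" if "norm x > r m" for x using zero[OF that] by (simp add: c_def)
  qed (auto intro!: continuous_intros c_cont cont)
  have ms: "F k \<in> borel_measurable lborel" "G k \<in> borel_measurable lborel" "c m \<in> borel_measurable lborel"
       "d m k \<in> borel_measurable lborel" for k m
    using borel_measurable_continuous_onI[OF cont(1)] borel_measurable_continuous_onI[OF cont(2)]
      borel_measurable_continuous_onI[OF c_cont(1)] borel_measurable_continuous_onI[OF c_cont(2)]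
    by simp_all
  have i1: "integrable lborel (\<lambda>x. d m k x * F k x)" for m k
  proof (rule Bochner_Integration.integrable_bound)
    show "integrable lborel (\<lambda>x. 4 / r m * F k x)" using int by simp
    show "AE x in lborel. norm (d m k x * F k x) \<le> norm (4 / r m * F k x)"
    proof (rule AE_I2)
      fix x
      have "\<bar>d m k x\<bar> * \<bar>F k x\<bar> \<le> 4 / r m * \<bar>F k x\<bar>"
        by (intro mult_right_mono d_le) simp
      then show "norm (d m k x * F k x) \<le> norm (4 / r m * F k x)"
        using r[of m] by (simp add: abs_mult)
    qed
  qed (use ms in auto)
  have i2: "integrable lborel (\<lambda>x. c m x * G k x)" for m k
  proof -
    have "integrable lborel (\<lambda>x. indicator (cball 0 (r m)) x *\<^sub>R (c m x * G k x))"
      by (rule borel_integrable_compact) (auto intro!: continuous_intros continuous_on_subset[OF c_cont(1)] continuous_on_subset[OF cont(2)])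
    moreover have "(\<lambda>x. indicator (cball 0 (r m)) x *\<^sub>R (c m x * G k x)) = (\<lambda>x. c m x * G k x)"
      using zero by (auto simp: indicator_def fun_eq_iff c_def)
    ultimately show ?thesis by simp
  qed
  \<comment> \<open>Behind the cutoff each \<open>G k\<close> is integrable by itself, so sum and
    integral may be exchanged here.\<close>
  have eq: "(LINT x|lborel. c m x * (\<Sum>k\<in>UNIV. G k x)) = - (LINT x|lborel. (\<Sum>k\<in>UNIV. d m k x * F k x))" for m
  proof -
    have "(LINT x|lborel. c m x * (\<Sum>k\<in>UNIV. G k x)) + (LINT x|lborel. (\<Sum>k\<in>UNIV. d m k x * F k x))
       = (\<Sum>k\<in>UNIV. (LINT x|lborel. c m x * G k x + d m k x * F k x))"
      using i1 i2 by (simp add: sum_distrib_left Bochner_Integration.integral_sum sum.distrib)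
    then show ?thesis using cF by simp
  qed
  have "(\<lambda>m. LINT x|lborel. c m x * (\<Sum>k\<in>UNIV. G k x)) \<longlonglongrightarrow> (LINT x|lborel. (\<Sum>k\<in>UNIV. G k x))"
  proof (rule integral_dominated_convergence[where w = "\<lambda>x. \<bar>\<Sum>k\<in>UNIV. G k x\<bar>"])
    show "AE x in lborel. (\<lambda>m. c m x * (\<Sum>k\<in>UNIV. G k x)) \<longlonglongrightarrow> (\<Sum>k\<in>UNIV. G k x)"
    proof (rule AE_I2)
      fix x
      have "(\<lambda>m. inverse (r m)) \<longlonglongrightarrow> 0" unfolding r_def by (rule LIMSEQ_inverse_real_of_nat)
      then have "(\<lambda>m. (max 0 (1 - (x \<bullet> x) * (inverse (r m))\<^sup>2))\<^sup>2 * (\<Sum>k\<in>UNIV. G k x)) \<longlonglongrightarrow> (max 0 (1 - (x \<bullet> x) * 0\<^sup>2))\<^sup>2 * (\<Sum>k\<in>UNIV. G k x)"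
        by (intro tendsto_intros)
      then show "(\<lambda>m. c m x * (\<Sum>k\<in>UNIV. G k x)) \<longlonglongrightarrow> (\<Sum>k\<in>UNIV. G k x)"
        by (simp add: c_def divide_inverse power_inverse)
    qed
    show "AE x in lborel. norm (c m x * (\<Sum>k\<in>UNIV. G k x)) \<le> \<bar>\<Sum>k\<in>UNIV. G k x\<bar>" for m
    proof (rule AE_I2)
      fix x
      have "c m x * \<bar>\<Sum>k\<in>UNIV. G k x\<bar> \<le> 1 * \<bar>\<Sum>k\<in>UNIV. G k x\<bar>"
        by (intro mult_right_mono c_le) simp
      then show "norm (c m x * (\<Sum>k\<in>UNIV. G k x)) \<le> \<bar>\<Sum>k\<in>UNIV. G k x\<bar>"
        using c_le(1)[of m x] by (simp only: real_norm_def abs_mult abs_of_nonneg mult_1)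
    qed
    show "(\<lambda>x. \<Sum>k\<in>UNIV. G k x) \<in> borel_measurable lborel"
      by (intro borel_measurable_sum ms)
    show "(\<lambda>x. c m x * (\<Sum>k\<in>UNIV. G k x)) \<in> borel_measurable lborel" for m
      by (intro borel_measurable_sum borel_measurable_times ms)
    show "integrable lborel (\<lambda>x. \<bar>\<Sum>k\<in>UNIV. G k x\<bar>)"
      by (intro integrable_abs int)
  qed
  moreover have "(\<lambda>m. - (LINT x|lborel. (\<Sum>k\<in>UNIV. d m k x * F k x))) \<longlonglongrightarrow> - (LINT x|(lborel :: (real^'n) measure). 0)"
  proof (intro tendsto_minus integral_dominated_convergence[where w = "\<lambda>x. \<Sum>k\<in>UNIV. 4 * \<bar>F k x\<bar>"])
    have d4: "\<bar>d m k x\<bar> \<le> 4" for m k x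
    proof -
      have "4 / r m \<le> 4 / 1" by (intro divide_left_mono) (use r[of m] in auto)
      then show ?thesis using d_le[of m k x] by linarith
    qed
    show "AE x in lborel. norm (\<Sum>k\<in>UNIV. d m k x * F k x) \<le> (\<Sum>k\<in>UNIV. 4 * \<bar>F k x\<bar>)" for m
      by (intro AE_I2 sum_norm_le) (simp add: abs_mult mult_right_mono d4)
    show "AE x in lborel. (\<lambda>m. \<Sum>k\<in>UNIV. d m k x * F k x) \<longlonglongrightarrow> 0"
    proof (intro AE_I2 tendsto_null_sum tendsto_mult_left_zero)
      fix x k
      have "(\<lambda>m. inverse (r m)) \<longlonglongrightarrow> 0" unfolding r_def by (rule LIMSEQ_inverse_real_of_nat)
      then have "(\<lambda>m. 4 * inverse (r m)) \<longlonglongrightarrow> 4 * 0" by (intro tendsto_intros)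
      then have l: "(\<lambda>m. 4 / r m) \<longlonglongrightarrow> 0" by (simp add: divide_inverse)
      show "(\<lambda>m. d m k x) \<longlonglongrightarrow> 0"
        by (rule Lim_null_comparison[OF _ l]) (simp add: d_le always_eventually)
    qed
    show "(\<lambda>x. \<Sum>k\<in>UNIV. d m k x * F k x) \<in> borel_measurable lborel" for m
      by (intro borel_measurable_sum borel_measurable_times ms)
    show "integrable lborel (\<lambda>x. \<Sum>k\<in>UNIV. 4 * \<bar>F k x\<bar>)"
      by (intro Bochner_Integration.integrable_sum integrable_mult_right integrable_abs int)
  qed simp
  ultimately have "(LINT x|lborel. (\<Sum>k\<in>UNIV. G k x)) = - (LINT x|(lborel :: (real^'n) measure). 0)"
    unfolding eq by (rule LIMSEQ_unique)
  then show ?thesis by simp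
qed

text \<open>The mean value inequality turns the bound on \<open>f'\<close> into one on difference
  quotients. It asks for differentiability in \<open>s\<close> only, as suits a time derivative of
  unknown continuity.\<close>

lemma has_derivative_integral_dominated:
  fixes f f' :: "real \<Rightarrow> 'a \<Rightarrow> real"
  assumes d: "\<And>s x. ((\<lambda>s. f s x) has_real_derivative f' s x) (at s)"
    and int: "\<And>s. integrable M (f s)" "f' t \<in> borel_measurable M" "integrable M g"
    and b: "\<And>s x. \<bar>f' s x\<bar> \<le> g x"
  shows "((\<lambda>s. LINT x|M. f s x) has_real_derivative (LINT x|M. f' t x)) (at t)"
proof -
  have "((\<lambda>s. LINT x|M. (f s x - f t x) / (s - t)) \<longlongrightarrow> (LINT x|M. f' t x)) (at t)"
  proof (rule tendsto_integral_at[where w = g])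
    show "(\<lambda>x. (f s x - f t x) / (s - t)) \<in> borel_measurable M" for s
      using int(1) by (intro borel_measurable_divide borel_measurable_diff borel_measurable_integrable) auto
    show "((\<lambda>s. (f s x - f t x) / (s - t)) \<longlongrightarrow> f' t x) (at t)" for x
      using d[of x t] by (simp add: has_field_derivative_iff)
    show "norm ((f s x - f t x) / (s - t)) \<le> g x" if "s \<noteq> t" for s x
    proof -
      have "norm (f s x - f t x) \<le> g x * norm (s - t)"
        by (rule field_differentiable_bound[where S = UNIV and f' = "\<lambda>s. f' s x"])
           (use d b in auto)
      then show ?thesis using that by (simp add: field_simps)
    qed
  qed (use int in auto)
  then have "((\<lambda>s. ((LINT x|M. f s x) - (LINT x|M. f t x)) / (s - t)) \<longlongrightarrow> (LINT x|M. f' t x)) (at t)"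
    using int(1) by simp
  then show ?thesis by (simp add: has_field_derivative_iff)
qed

text \<open>With integral 0 the set where \<open>f\<close> is nonzero would be open and null, hence
  empty.\<close>

lemma integral_pos_of_continuous:
  fixes f :: "'a::euclidean_space \<Rightarrow> real"
  assumes f: "integrable lborel f" "continuous_on UNIV f" "\<And>x. 0 \<le> f x" and x: "f x \<noteq> 0"
  shows "0 < (LINT x|lborel. f x)"
proof (rule ccontr)
  assume "\<not> ?thesis"
  moreover have "0 \<le> (LINT x|lborel. f x)" using f by (intro integral_nonneg_AE) auto
  ultimately have "(LINT x|lborel. f x) = 0" by simp
  then have "AE x in lborel. f x = 0"
    using integral_nonneg_eq_0_iff_AE[OF f(1)] f(3) by auto
  then have "emeasure lborel {x. f x \<noteq> 0} = 0"
    using f by (subst (asm) AE_iff_measurable[OF _ refl]) (auto intro: borel_measurable_integrable)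
  moreover have "open {x. f x \<noteq> 0}"
    using f(2) by (intro open_Collect_neq) (auto)
  ultimately have "{x. f x \<noteq> 0} = {}"
    using open_not_negligible[of "{x. f x \<noteq> 0}"]
    by (auto simp: negligible_iff_emeasure0 null_sets_def intro: null_setsI)
  then show False using x by blast
qed

section \<open>Decay of the gradient of the ground state\<close>

text \<open>Writing \<open>Q x = q \<bar>x\<bar>\<close>, the equation reads \<open>(r\<^bsup>n-1\<^esup> q')' = r\<^bsup>n-1\<^esup> (q - q\<^bsup>p+1\<^esup>)\<close>. On \<open>[r, r + 1]\<close> the
  mean value theorem yields a point where \<open>q'\<close> is as small as \<open>q\<close>, and the equation transports this bound to \<open>r\<close>.\<close>

lemma ground_state_gradient_decay:
  fixes Q :: "real^'n::finite \<Rightarrow> real"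
  assumes "ground_state p Q" and p: "0 < p"
  shows "\<exists>C>0. \<exists>\<gamma>>0. \<forall>x. \<bar>Q x\<bar> \<le> C * exp (- \<gamma> * norm x) \<and> (\<forall>k. \<bar>partial k Q x\<bar> \<le> C * exp (- \<gamma> * norm x))"
proof -
  obtain C \<gamma> where C: "C > 0" "\<gamma> > 0" "\<And>x. \<bar>Q x\<bar> \<le> C * exp (- \<gamma> * norm x)"
    using assms unfolding ground_state_def by blast
  have rad: "\<And>x y. norm x = norm y \<Longrightarrow> Q x = Q y" and C2: "C_k 2 Q"
    and eq0: "\<And>x. - laplacian Q x + Q x - \<bar>Q x\<bar> powr p * Q x = 0"
    using assms unfolding ground_state_def by blast+
  have eq: "laplacian Q x = Q x - \<bar>Q x\<bar> powr p * Q x" for x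
    using eq0[of x] by linarith
  have P1: "has_partial k Q (partial k Q)" for k
    using C2 by (intro partial_has_partial) (simp add: numeral_2_eq_2)
  have P2: "has_partial k (partial k Q) (partial k (partial k Q))" for k
    using C2 by (intro partial_has_partial) (simp add: numeral_2_eq_2)
  have Pc: "continuous_on UNIV (partial k Q)" for k
    using C2 by (auto simp: numeral_2_eq_2 intro!: continuous_at_imp_continuous_on differentiable_imp_continuous_within)
  define i :: 'n where "i = undefined"
  define e where "e = (axis i 1 :: real^'n)"
  have ne: "norm (r *\<^sub>R e) = \<bar>r\<bar>" for r by (simp add: e_def)
  define q where "q r = Q (r *\<^sub>R e)" for r
  define q1 where "q1 r = partial i Q (r *\<^sub>R e)" for r
  define q2 where "q2 r = partial i (partial i Q) (r *\<^sub>R e)" for r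
  have dq: "(q has_real_derivative q1 r) (at r)" for r
    using has_partial_line[OF P1[of i], where x = 0 and s = r and S = UNIV]
    by (simp add: q_def[abs_def] q1_def e_def has_real_derivative_iff_has_vector_derivative)
  have dq1: "(q1 has_real_derivative q2 r) (at r)" for r
    using has_partial_line[OF P2[of i], where x = 0 and s = r and S = UNIV]
    by (simp add: q1_def[abs_def] q2_def e_def has_real_derivative_iff_has_vector_derivative)
  have Qq: "Q x = q (norm x)" for x unfolding q_def by (rule rad) (simp add: e_def)
  have grad: "partial k Q x = q1 (norm x) * (x $ k / norm x)" if "x \<noteq> 0" for k x
  proof -
    have "((\<lambda>s. sqrt ((x + s *\<^sub>R axis k 1) \<bullet> (x + s *\<^sub>R axis k 1))) has_real_derivative
        (inverse (sqrt ((x + 0 *\<^sub>R axis k 1) \<bullet> (x + 0 *\<^sub>R axis k 1))) / 2) * (2 * x $ k)) (at 0)"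
      using that by (intro DERIV_chain2[OF DERIV_real_sqrt] has_real_derivative_norm_sq_line) auto
    then have "((\<lambda>s. norm (x + s *\<^sub>R axis k 1)) has_real_derivative x $ k / norm x) (at 0)"
      unfolding norm_eq_sqrt_inner[symmetric] by (simp add: field_simps)
    then have "((\<lambda>s. q (norm (x + s *\<^sub>R axis k 1))) has_real_derivative q1 (norm (x + 0 *\<^sub>R axis k 1)) * (x $ k / norm x)) (at 0)"
      by (intro DERIV_chain2[OF dq])
    then have "((\<lambda>s. Q (x + s *\<^sub>R axis k 1)) has_vector_derivative q1 (norm x) * (x $ k / norm x)) (at 0)"
      by (simp add: Qq[symmetric] has_real_derivative_iff_has_vector_derivative)
    then show ?thesis
      using P1[of k] unfolding has_partial_def by (intro vector_derivative_unique_at) auto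
  qed
  \<comment> \<open>On the line through \<open>r *\<^sub>R e\<close> in a direction orthogonal to
    \<open>e\<close>, \<open>partial k Q\<close> equals
    \<open>q1 (\<rho> s) * (s / \<rho> s)\<close>. It vanishes at \<open>s = 0\<close>, so
    continuity of \<open>q1\<close> alone gives its derivative there.\<close>
  have second: "partial k (partial k Q) (r *\<^sub>R e) = q1 r / r" if r: "r > 0" and k: "k \<noteq> i" for k r
  proof -
    define \<rho> where "\<rho> s = norm (r *\<^sub>R e + s *\<^sub>R axis k 1)" for s
    have nz: "r *\<^sub>R e + s *\<^sub>R axis k 1 \<noteq> 0" for s
    proof
      assume "r *\<^sub>R e + s *\<^sub>R axis k 1 = 0"
      then have "(r *\<^sub>R e + s *\<^sub>R axis k 1) $ i = 0" by simp
      then show False using r k by (simp add: e_def axis_def)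
    qed
    have comp: "(r *\<^sub>R e + s *\<^sub>R axis k 1) $ k = s" for s
      using k by (simp add: e_def axis_def)
    have g: "partial k Q (r *\<^sub>R e + s *\<^sub>R axis k 1) = q1 (\<rho> s) * (s / \<rho> s)" for s
      using grad[OF nz[of s], of k] comp[of s] by (simp add: \<rho>_def)
    have \<rho>0: "\<rho> 0 = r" using r by (simp add: \<rho>_def e_def)
    have "isCont q1 x" for x using dq1 DERIV_isCont by blast
    moreover have "isCont \<rho> 0" unfolding \<rho>_def by (intro continuous_intros)
    ultimately have "isCont (\<lambda>s. q1 (\<rho> s)) 0"
      using isCont_o2 by blast
    then have "isCont (\<lambda>s. q1 (\<rho> s) / \<rho> s) 0"
      using \<open>isCont \<rho> 0\<close> r \<rho>0 by (intro continuous_intros) auto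
    then have "((\<lambda>s. q1 (\<rho> s) / \<rho> s) \<longlongrightarrow> q1 r / r) (at 0)"
      by (simp add: isCont_def \<rho>0)
    then have "((\<lambda>s. (q1 (\<rho> s) * (s / \<rho> s) - q1 (\<rho> 0) * (0 / \<rho> 0)) / s) \<longlongrightarrow> q1 r / r) (at 0)"
      by (rule Lim_transform_eventually) (auto simp: eventually_at intro!: exI[of _ 1])
    then have "((\<lambda>s. q1 (\<rho> s) * (s / \<rho> s)) has_real_derivative q1 r / r) (at 0)"
      by (simp add: DERIV_def)
    then have "((\<lambda>s. partial k Q (r *\<^sub>R e + s *\<^sub>R axis k 1)) has_vector_derivative q1 r / r) (at 0)"
      by (simp add: g has_real_derivative_iff_has_vector_derivative)
    then show ?thesis
      using P2[of k] unfolding has_partial_def by (intro vector_derivative_unique_at) auto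
  qed
  let ?n = "CARD('n)"
  define G where "G r = q r - \<bar>q r\<bar> powr p * q r" for r
  have ode: "q2 r + real (?n - 1) * (q1 r / r) = G r" if r: "r > 0" for r
  proof -
    have "laplacian Q (r *\<^sub>R e) = q2 r + (\<Sum>k\<in>UNIV - {i}. partial k (partial k Q) (r *\<^sub>R e))"
      unfolding laplacian_def by (subst sum.remove[of _ i]) (auto simp: q2_def)
    also have "(\<Sum>k\<in>UNIV - {i}. partial k (partial k Q) (r *\<^sub>R e)) = (\<Sum>k\<in>UNIV - {i}. q1 r / r)"
      by (intro sum.cong) (auto simp: second r)
    also have "\<dots> = real (?n - 1) * (q1 r / r)" by (simp add: card_Diff_subset)
    finally show ?thesis by (simp add: eq G_def q_def)
  qed
  \<comment> \<open>The integrating factor \<open>r ^ (?n - 1)\<close> removes the first order term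
    of the radial equation.\<close>
  define H where "H r = r ^ (?n - 1) * q1 r" for r
  have dH: "(H has_real_derivative r ^ (?n - 1) * G r) (at r)" if r: "r > 0" for r
  proof -
    have "(H has_real_derivative (real (?n - 1) * r ^ (?n - 1 - 1)) * q1 r + q2 r * r ^ (?n - 1)) (at r)"
      unfolding H_def by (rule DERIV_mult) (use DERIV_pow[of "?n - 1" r UNIV] dq1 in auto)
    \<comment> \<open>In dimension one the truncated exponent \<open>?n - 1 - 1\<close> is 0, but
      its coefficient vanishes as well; hence the case split.\<close>
    moreover have "(real (?n - 1) * r ^ (?n - 1 - 1)) * q1 r + q2 r * r ^ (?n - 1) = r ^ (?n - 1) * G r"
      unfolding ode[OF r, symmetric] using r by (cases "?n - 1") (auto simp: field_simps)
    ultimately show ?thesis by simp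
  qed
  have qb: "\<bar>q r\<bar> \<le> C * exp (- \<gamma> * s)" if "0 \<le> s" "s \<le> r" for r s
  proof -
    have "\<bar>q r\<bar> \<le> C * exp (- \<gamma> * r)" using C(3)[of "r *\<^sub>R e"] that by (simp add: q_def e_def)
    also have "\<dots> \<le> C * exp (- \<gamma> * s)" using that C by simp
    finally show ?thesis .
  qed
  define D where "D = C + C powr p * C"
  have Gb: "\<bar>G r\<bar> \<le> D * exp (- \<gamma> * s)" if "0 \<le> s" "s \<le> r" for r s
  proof -
    have "\<bar>q r\<bar> \<le> C" using qb[of 0 r] that by simp
    then have "\<bar>q r\<bar> powr p \<le> C powr p" using p by (intro powr_mono2) auto
    then have "\<bar>q r\<bar> powr p * \<bar>q r\<bar> \<le> C powr p * (C * exp (- \<gamma> * s))"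
      using qb[OF that] by (intro mult_mono) auto
    moreover have "\<bar>G r\<bar> \<le> \<bar>q r\<bar> + \<bar>q r\<bar> powr p * \<bar>q r\<bar>"
      unfolding G_def using abs_triangle_ineq4[of "q r" "\<bar>q r\<bar> powr p * q r"] by (simp add: abs_mult)
    ultimately show ?thesis using qb[OF that] by (simp add: D_def algebra_simps)
  qed
  have q1b: "\<bar>q1 r\<bar> \<le> 2 ^ (?n - 1) * (2 * C + D) * exp (- \<gamma> * r)" if r: "r \<ge> 1" for r
  proof -
    obtain \<xi> where \<xi>: "r < \<xi>" "\<xi> < r + 1" "q (r + 1) - q r = (r + 1 - r) * q1 \<xi>"
      using MVT2[of r "r + 1" q q1] dq by auto
    obtain \<eta> where \<eta>: "r < \<eta>" "\<eta> < \<xi>" "H \<xi> - H r = (\<xi> - r) * (\<eta> ^ (?n - 1) * G \<eta>)"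
      using MVT2[of r \<xi> H "\<lambda>r. r ^ (?n - 1) * G r"] dH \<xi> r by force
    let ?E = "exp (- \<gamma> * r)"
    have a: "\<bar>q1 \<xi>\<bar> \<le> 2 * C * ?E" using \<xi>(3) qb[of r r] qb[of r "r + 1"] r by simp
    have b: "\<bar>G \<eta>\<bar> \<le> D * ?E" using Gb[of r \<eta>] \<eta> r by simp
    \<comment> \<open>Both points lie below \<open>r + 1 \<le> 2 * r\<close>, which is where
      \<open>r \<ge> 1\<close> enters and where the factor \<open>2 ^ (?n - 1)\<close>
      originates.\<close>
    have pw: "\<xi> ^ (?n - 1) \<le> (2 * r) ^ (?n - 1)" "\<eta> ^ (?n - 1) \<le> (2 * r) ^ (?n - 1)"
      using \<xi>(1,2) \<eta>(1,2) r by (intro power_mono; linarith)+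
    have "H r = \<xi> ^ (?n - 1) * q1 \<xi> - (\<xi> - r) * (\<eta> ^ (?n - 1) * G \<eta>)"
      using \<eta>(3) unfolding H_def by linarith
    moreover have "r ^ (?n - 1) * \<bar>q1 r\<bar> = \<bar>H r\<bar>" using r by (simp add: H_def abs_mult)
    ultimately have "r ^ (?n - 1) * \<bar>q1 r\<bar> = \<bar>\<xi> ^ (?n - 1) * q1 \<xi> - (\<xi> - r) * (\<eta> ^ (?n - 1) * G \<eta>)\<bar>"
      by simp
    also have "\<dots> \<le> \<xi> ^ (?n - 1) * \<bar>q1 \<xi>\<bar> + (\<xi> - r) * (\<eta> ^ (?n - 1) * \<bar>G \<eta>\<bar>)"
      using abs_triangle_ineq4[of "\<xi> ^ (?n - 1) * q1 \<xi>" "(\<xi> - r) * (\<eta> ^ (?n - 1) * G \<eta>)"] \<xi> \<eta> r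
      by (simp add: abs_mult)
    also have "\<dots> \<le> (2 * r) ^ (?n - 1) * (2 * C * ?E) + 1 * ((2 * r) ^ (?n - 1) * (D * ?E))"
      using \<xi> \<eta> r a b by (intro add_mono mult_mono pw) auto
    also have "\<dots> = r ^ (?n - 1) * (2 ^ (?n - 1) * (2 * C + D) * ?E)"
      by (simp add: power_mult_distrib algebra_simps)
    finally show ?thesis using r by simp
  qed
  have "bounded (\<Union>k. partial k Q ` cball 0 1)"
    by (intro bounded_UN ballI compact_imp_bounded compact_continuous_image continuous_on_subset[OF Pc]) auto
  then obtain B where B: "\<And>k x. norm x \<le> 1 \<Longrightarrow> \<bar>partial k Q x\<bar> \<le> B"
    unfolding bounded_iff by fastforce
  \<comment> \<open>One constant for three tasks: \<open>Q\<close> itself, the gradient on the unit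
    ball (where \<open>exp \<gamma>\<close> offsets the decay factor), and the gradient outside
    it.\<close>
  define A where "A = max (C) (max (B * exp \<gamma>) (2 ^ (?n - 1) * (2 * C + D)))"
  have "\<bar>partial k Q x\<bar> \<le> A * exp (- \<gamma> * norm x)" for k x
  proof (cases "norm x \<le> 1")
    case True
    have "B \<ge> 0" using order_trans[OF abs_ge_zero B[of 0]] by simp
    have "\<bar>partial k Q x\<bar> \<le> B * 1" using B True by simp
    also have "\<dots> \<le> B * exp (\<gamma> * (1 - norm x))"
      using True C \<open>B \<ge> 0\<close> by (intro mult_left_mono) auto
    also have "\<dots> = (B * exp \<gamma>) * exp (- \<gamma> * norm x)" by (simp add: mult_exp_exp algebra_simps)
    also have "\<dots> \<le> A * exp (- \<gamma> * norm x)" by (intro mult_right_mono) (auto simp: A_def)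
    finally show ?thesis .
  next
    case False
    have "\<bar>x $ k / norm x\<bar> \<le> 1" using False component_le_norm_cart[of x k] by (simp add: divide_le_eq abs_divide)
    then have "\<bar>q1 (norm x)\<bar> * \<bar>x $ k / norm x\<bar> \<le> \<bar>q1 (norm x)\<bar> * 1"
      by (intro mult_left_mono) auto
    moreover have "x \<noteq> 0" using False by auto
    ultimately have "\<bar>partial k Q x\<bar> \<le> \<bar>q1 (norm x)\<bar>" by (simp add: grad abs_mult)
    also have "\<dots> \<le> 2 ^ (?n - 1) * (2 * C + D) * exp (- \<gamma> * norm x)" using q1b False by simp
    also have "\<dots> \<le> A * exp (- \<gamma> * norm x)" by (intro mult_right_mono) (auto simp: A_def)
    finally show ?thesis .
  qed
  moreover have "\<bar>Q x\<bar> \<le> A * exp (- \<gamma> * norm x)" for x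
  proof -
    have "C * exp (- \<gamma> * norm x) \<le> A * exp (- \<gamma> * norm x)" by (intro mult_right_mono) (auto simp: A_def)
    then show ?thesis using C(3)[of x] by linarith
  qed
  moreover have "A > 0" using C by (simp add: A_def)
  ultimately show ?thesis using C(2) by blast
qed

section \<open>Families with a common decay rate\<close>

text \<open>\<open>K\<close> is uniform in the index, which is typically time; this is what
  dominated convergence in time requires. Continuity supplies measurability. A single function is
  treated as a constant family over a dummy index.\<close>

definition dominated :: "('a::metric_space \<Rightarrow> real) \<Rightarrow> ('i \<Rightarrow> 'a \<Rightarrow> 'b::real_normed_vector) \<Rightarrow> bool" where
  "dominated m F \<longleftrightarrow> (\<forall>i. continuous_on UNIV (F i)) \<and> (\<exists>K. \<forall>i x. norm (F i x) \<le> K * m x)"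

lemma dominated_cont: "dominated m F \<Longrightarrow> continuous_on UNIV (F i)"
  by (simp add: dominated_def)

lemma dominated_bound:
  assumes "dominated m F" "\<And>x. m x \<ge> 0"
  obtains K where "K \<ge> 0" "\<And>i x. norm (F i x) \<le> K * m x"
proof -
  obtain K where K: "\<And>i x. norm (F i x) \<le> K * m x" using assms by (auto simp: dominated_def)
  have "norm (F i x) \<le> max 0 K * m x" for i x
    by (rule order_trans[OF K mult_right_mono]) (use assms in auto)
  then show ?thesis by (rule that[rotated]) simp
qed

lemma dominated_add:
  assumes "dominated m F" "dominated m G"
  shows "dominated m (\<lambda>i x. F i x + G i x)"
proof -
  obtain K L where "\<And>i x. norm (F i x) \<le> K * m x" "\<And>i x. norm (G i x) \<le> L * m x"
    using assms unfolding dominated_def by auto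
  then have "norm (F i x + G i x) \<le> (K + L) * m x" for i x
    by (metis norm_triangle_mono distrib_right)
  then show ?thesis using assms by (auto simp: dominated_def intro!: continuous_intros)
qed

lemma dominated_diff:
  assumes "dominated m F" "dominated m G"
  shows "dominated m (\<lambda>i x. F i x - G i x)"
proof -
  have "dominated m (\<lambda>i x. - G i x)" using assms(2) by (auto simp: dominated_def intro!: continuous_intros)
  from dominated_add[OF assms(1) this] show ?thesis by simp
qed

lemma dominated_sum:
  assumes "finite I" "\<And>j. j \<in> I \<Longrightarrow> dominated m (F j)" "\<And>x. m x \<ge> 0"
  shows "dominated m (\<lambda>i x. \<Sum>j\<in>I. F j i x)"
  using assms
proof (induction I rule: finite_induct)
  case empty
  then show ?case by (auto simp: dominated_def intro!: exI[of _ 0])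
next
  case (insert j I)
  then show ?case by (simp add: dominated_add)
qed

lemma dominated_mult:
  fixes F G :: "'i \<Rightarrow> 'a::metric_space \<Rightarrow> 'b::real_normed_algebra"
  assumes "dominated m F" "dominated m' G" "\<And>x. 0 \<le> m x"
  shows "dominated (\<lambda>x. m x * m' x) (\<lambda>i x. F i x * G i x)"
proof -
  obtain K L where K: "\<And>i x. norm (F i x) \<le> K * m x" "\<And>i x. norm (G i x) \<le> L * m' x"
    using assms unfolding dominated_def by auto
  have "norm (F i x * G i x) \<le> (K * L) * (m x * m' x)" for i x
  proof -
    have "norm (F i x * G i x) \<le> norm (F i x) * norm (G i x)" by (rule norm_mult_ineq)
    also have "\<dots> \<le> (K * m x) * (L * m' x)"
      by (intro mult_mono K) (auto intro: order_trans[OF norm_ge_zero K(1)])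
    finally show ?thesis by (simp add: algebra_simps)
  qed
  then show ?thesis using assms by (auto simp: dominated_def intro!: continuous_intros)
qed

lemma dominated_mono:
  assumes "dominated m F" "\<And>x. 0 \<le> m x" "\<And>x. m x \<le> m' x"
  shows "dominated m' F"
proof -
  obtain K where K: "K \<ge> 0" "\<And>i x. norm (F i x) \<le> K * m x" using dominated_bound assms by blast
  have "norm (F i x) \<le> K * m' x" for i x
    by (rule order_trans[OF K(2) mult_left_mono]) (use assms K in auto)
  then show ?thesis using assms by (auto simp: dominated_def)
qed

lemma dominated_cmult:
  fixes F :: "'i \<Rightarrow> 'a::metric_space \<Rightarrow> 'b::real_normed_algebra"
  assumes "dominated m F"
  shows "dominated m (\<lambda>i x. c * F i x)"
proof -
  obtain K where K: "\<And>i x. norm (F i x) \<le> K * m x"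
    using assms unfolding dominated_def by auto
  have "norm (c * F i x) \<le> (norm c * K) * m x" for i x
    using order_trans[OF norm_mult_ineq mult_left_mono[OF K norm_ge_zero]] by (simp add: mult.assoc)
  then show ?thesis using assms by (auto simp: dominated_def intro!: continuous_intros)
qed

lemma dominated_inner:
  fixes F G :: "'i \<Rightarrow> 'a::metric_space \<Rightarrow> 'b::real_inner"
  assumes "dominated m F" "dominated m G" "\<And>x. 0 \<le> m x" "\<And>x. m x \<le> 1"
  shows "dominated m (\<lambda>i x. F i x \<bullet> G i x)"
proof -
  obtain K L where K: "K \<ge> 0" "\<And>i x. norm (F i x) \<le> K * m x" "L \<ge> 0" "\<And>i x. norm (G i x) \<le> L * m x"
    using dominated_bound assms by metis
  have "norm (F i x \<bullet> G i x) \<le> (K * L) * m x" for i x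
  proof -
    have "norm (F i x \<bullet> G i x) \<le> norm (F i x) * norm (G i x)"
      by (simp add: Cauchy_Schwarz_ineq2)
    also have "\<dots> \<le> (K * m x) * (L * m x)"
      by (intro mult_mono K) (use K assms in auto)
    also have "\<dots> \<le> (K * m x) * (L * 1)"
      by (intro mult_left_mono) (use K assms in auto)
    finally show ?thesis by (simp add: algebra_simps)
  qed
  then show ?thesis using assms by (auto simp: dominated_def intro!: continuous_intros)
qed

section \<open>Conservation laws of decaying solutions\<close>

text \<open>The interface between breathers and conservation laws. Decay is imposed on
  \<open>u\<close>, its gradient and \<open>ut\<close>, not on single second partials. Continuity in
  time is imposed on the gradient, not on the Laplacian.\<close>

locale decaying_solution =
  fixes p C \<gamma> :: real and u ut :: "real \<Rightarrow> real^'n::finite \<Rightarrow> complex"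
  assumes p: "0 < p" and \<gamma>: "0 < \<gamma>"
    and C2: "C_k 2 (u t)"
    and time_derivative: "((\<lambda>s. u s x) has_vector_derivative ut t x) (at t)"
    and equation: "ut t x = \<i> * (laplacian (u t) x + of_real (norm (u t x) powr p) * u t x)"
    and decay: "norm (u t x) \<le> C * exp (- \<gamma> * norm x)"
      "norm (partial k (u t) x) \<le> C * exp (- \<gamma> * norm x)"
      "norm (ut t x) \<le> C * exp (- \<gamma> * norm x)"
    and gradient_tendsto: "((\<lambda>s. partial k (u s) x) \<longlongrightarrow> partial k (u t) x) (at t)"
begin

abbreviation E :: "real^'n \<Rightarrow> real" where "E x \<equiv> exp (- \<gamma> * norm x)"
abbreviation lin :: "real^'n \<Rightarrow> real" where "lin x \<equiv> 1 + norm x"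
abbreviation decays :: "('i \<Rightarrow> real^'n \<Rightarrow> 'b::real_normed_vector) \<Rightarrow> bool" where "decays \<equiv> dominated E"
abbreviation wdecays :: "('i \<Rightarrow> real^'n \<Rightarrow> 'b::real_normed_vector) \<Rightarrow> bool" where "wdecays \<equiv> dominated (\<lambda>x. lin x * E x)"
abbreviation grows :: "('i \<Rightarrow> real^'n \<Rightarrow> 'b::real_normed_vector) \<Rightarrow> bool" where "grows \<equiv> dominated lin"

abbreviation du :: "'n \<Rightarrow> real \<Rightarrow> real^'n \<Rightarrow> complex" where "du k t \<equiv> partial k (u t)"
abbreviation L :: "real \<Rightarrow> real^'n \<Rightarrow> complex" where "L t \<equiv> laplacian (u t)"
abbreviation \<phi> :: "real \<Rightarrow> real^'n \<Rightarrow> complex" where "\<phi> t x \<equiv> of_real (norm (u t x) powr p) * u t x"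
text \<open>The value at \<open>s = t\<close> is 0, so bounds on the quotient hold for every
  \<open>s\<close>.\<close>

definition quot :: "real \<Rightarrow> real \<Rightarrow> real^'n \<Rightarrow> complex" where
  "quot t s x = (u s x - u t x) /\<^sub>R (s - t)"

section \<open>Decay, integrability and limits in time\<close>

lemma E_le_1: "E x \<le> 1" using \<gamma> by simp

lemma decays_imp_wdecays: "decays F \<Longrightarrow> wdecays F"
  by (rule dominated_mono) (auto simp: algebra_simps)

lemma wdecays_integrable:
  fixes F :: "'i \<Rightarrow> real^'n \<Rightarrow> 'b::{banach, second_countable_topology}"
  assumes "wdecays F" shows "integrable lborel (F i)"
proof -
  obtain K where "\<And>i x. norm (F i x) \<le> K * (lin x * E x)" using assms unfolding dominated_def by blast
  then show ?thesis using integrable_of_weight_bound[OF dominated_cont[OF assms] \<gamma>] by blast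
qed

lemma decays_integrable:
  fixes F :: "'i \<Rightarrow> real^'n \<Rightarrow> 'b::{banach, second_countable_topology}"
  shows "decays F \<Longrightarrow> integrable lborel (F i)"
  by (intro wdecays_integrable decays_imp_wdecays)

lemma wdecays_mult:
  fixes F G :: "'i \<Rightarrow> real^'n \<Rightarrow> real"
  shows "grows F \<Longrightarrow> decays G \<Longrightarrow> wdecays (\<lambda>i x. F i x * G i x)"
  by (rule dominated_mult) auto

lemma decays_inner:
  fixes F G :: "'i \<Rightarrow> real^'n \<Rightarrow> complex"
  shows "decays F \<Longrightarrow> decays G \<Longrightarrow> decays (\<lambda>i x. F i x \<bullet> G i x)"
  by (rule dominated_inner) (use E_le_1 in auto)

lemma decays_sum: "(\<And>k. decays (F k)) \<Longrightarrow> decays (\<lambda>i x. \<Sum>k\<in>(UNIV::'n set). F k i x)"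
  by (rule dominated_sum) auto

lemma wdecays_sum: "(\<And>k. wdecays (F k)) \<Longrightarrow> wdecays (\<lambda>i x. \<Sum>k\<in>(UNIV::'n set). F k i x)"
  by (rule dominated_sum) auto

lemma grows_affine: "grows (\<lambda>(i::'i) x. d + b \<bullet> (x::real^'n))"
proof -
  have "\<bar>d + b \<bullet> x\<bar> \<le> (\<bar>d\<bar> + norm b) * lin x" for x :: "real^'n"
  proof -
    have "\<bar>d + b \<bullet> x\<bar> \<le> \<bar>d\<bar> + norm b * norm x"
      using abs_triangle_ineq[of d "b \<bullet> x"] Cauchy_Schwarz_ineq2[of b x] by linarith
    also have "\<dots> \<le> (\<bar>d\<bar> + norm b) * lin x" by (simp add: algebra_simps)
    finally show ?thesis .
  qed
  then show ?thesis unfolding dominated_def by (auto intro!: continuous_intros exI[of _ "\<bar>d\<bar> + norm b"])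
qed

lemma grows_coord: "grows (\<lambda>(i::'i) x. d + c * (x::real^'n) $ k)"
  using grows_affine[of d "c *\<^sub>R axis k 1"] by (simp add: inner_axis')

lemmas partials = C_k_2_has_partials[OF C2]

lemma decays_u: "decays (\<lambda>i. u (\<tau> i))"
  using decay(1) partials(3) by (auto simp: dominated_def)

lemma decays_du: "decays (\<lambda>i. du k (\<tau> i))"
  using decay(2) partials(4) by (auto simp: dominated_def)

lemma continuous_\<phi>: "continuous_on UNIV (\<phi> t)"
  by (intro continuous_on_mult continuous_on_of_real continuous_on_powr' continuous_on_norm
      continuous_on_const partials) (use p in auto)

lemma decays_\<phi>: "decays (\<lambda>i. \<phi> (\<tau> i))"
proof -
  have C0: "0 \<le> C" using order_trans[OF norm_ge_zero decay(1)[of 0 0]] by simp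
  have "norm (\<phi> t x) \<le> (C powr p * C) * E x" for t x
  proof -
    have "norm (u t x) \<le> C" using decay(1)[of t x] E_le_1[of x] C0
      by (meson mult_left_le order_trans)
    then have "norm (u t x) powr p * norm (u t x) \<le> C powr p * (C * E x)"
      using p by (intro mult_mono powr_mono2 decay) auto
    then show ?thesis by (simp add: norm_mult mult.assoc)
  qed
  with continuous_\<phi> show ?thesis by (auto simp: dominated_def)
qed

lemma laplacian_eq: "L t x = - \<i> * ut t x - \<phi> t x"
  unfolding equation by (simp add: algebra_simps)

lemma continuous_L: "continuous_on UNIV (L t)"
  unfolding laplacian_def by (intro continuous_intros partials)

lemma decays_ut: "decays (\<lambda>i. ut (\<tau> i))"
proof -
  have "ut t = (\<lambda>x. \<i> * (L t x + \<phi> t x))" for t by (simp add: equation fun_eq_iff)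
  moreover have "continuous_on UNIV (\<lambda>x. \<i> * (L t x + \<phi> t x))" for t
    by (intro continuous_intros continuous_\<phi> continuous_L)
  ultimately have "continuous_on UNIV (ut t)" for t by simp
  then show ?thesis using decay(3) by (auto simp: dominated_def)
qed

text \<open>The equation expresses the Laplacian through \<open>ut\<close> and the nonlinearity,
  both of which decay, so the second partials need not be estimated.\<close>

lemma decays_L: "decays (\<lambda>i. L (\<tau> i))"
  unfolding laplacian_eq by (intro dominated_diff dominated_cmult decays_ut decays_\<phi>)

text \<open>The mean value inequality in time transfers the decay of \<open>ut\<close> to the
  quotients, uniformly in \<open>s\<close>.\<close>

lemma decays_quot: "decays (\<lambda>i. quot t (\<tau> i))"
proof -
  have "norm (quot t s x) \<le> C * E x" for s x
  proof (cases "s = t")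
    case True
    then show ?thesis using order_trans[OF norm_ge_zero decay(1)] by (simp add: quot_def)
  next
    case False
    have "norm (u s x - u t x) \<le> (C * E x) * norm (s - t)"
      using time_derivative decay(3)
      by (intro differentiable_bound[where S = UNIV and f' = "\<lambda>s h. h *\<^sub>R ut s x"])
         (auto simp: has_vector_derivative_def onorm_scaleR_left onorm_id
            intro!: onorm_bound order_trans[OF norm_ge_zero decay(1)] mult_left_mono)
    then show ?thesis using False by (simp add: quot_def divide_simps mult_ac)
  qed
  moreover have "continuous_on UNIV (quot t s)" for s
    unfolding quot_def by (intro continuous_intros partials)
  ultimately show ?thesis by (auto simp: dominated_def)
qed

lemma quot_tendsto: "((\<lambda>s. quot t s x) \<longlongrightarrow> ut t x) (at t)"
proof -
  let ?q = "\<lambda>s. norm ((u s x - u t x) - (s - t) *\<^sub>R ut t x) / norm (s - t)"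
  have q: "(?q \<longlongrightarrow> 0) (at t)"
    using time_derivative[of x t] by (simp add: has_vector_derivative_def has_derivative_iff_norm)
  have eq: "?q s = norm (quot t s x - ut t x)" if "s \<noteq> t" for s
  proof -
    have "quot t s x - ut t x = inverse (s - t) *\<^sub>R ((u s x - u t x) - (s - t) *\<^sub>R ut t x)"
      using that by (simp add: quot_def scaleR_right_diff_distrib)
    then show ?thesis
      unfolding real_norm_def divide_inverse by (simp only: norm_scaleR abs_inverse mult.commute)
  qed
  have "((\<lambda>s. norm (quot t s x - ut t x)) \<longlongrightarrow> 0) (at t)"
    by (rule Lim_transform_eventually[OF q], unfold eventually_at_filter)
       (intro always_eventually allI impI eq)
  then show ?thesis by (rule LIM_zero_cancel[OF tendsto_norm_zero_cancel])
qed

lemma integral_divergence: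
  fixes F G :: "'n \<Rightarrow> 'i \<Rightarrow> real^'n \<Rightarrow> real"
  assumes "\<And>k. has_partial k (F k i) (G k i)" "\<And>k. continuous_on UNIV (G k i)"
    and "\<And>k. wdecays (F k)" "wdecays (\<lambda>i x. \<Sum>k\<in>UNIV. G k i x)"
  shows "(LINT x|lborel. (\<Sum>k\<in>UNIV. G k i x)) = 0"
  by (rule integral_divergence_eq_0[of "\<lambda>k. F k i"])
     (use assms in \<open>auto intro: dominated_cont wdecays_integrable[of "\<lambda>i x. \<Sum>k\<in>UNIV. G k i x"] wdecays_integrable[of "F _"]\<close>)

lemma integral_tendsto_at:
  fixes F :: "real \<Rightarrow> real^'n \<Rightarrow> real"
  assumes "wdecays F" "\<And>x. ((\<lambda>s. F s x) \<longlongrightarrow> G x) (at t)" "continuous_on UNIV G"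
  shows "((\<lambda>s. LINT x|lborel. F s x) \<longlongrightarrow> (LINT x|lborel. G x)) (at t)"
proof -
  obtain K where K: "\<And>s x. norm (F s x) \<le> K * (lin x * E x)" using assms(1) unfolding dominated_def by blast
  have m: "F s \<in> borel_measurable lborel" "G \<in> borel_measurable lborel" for s
    using borel_measurable_continuous_onI[OF dominated_cont[OF assms(1), of s]]
      borel_measurable_continuous_onI[OF assms(3)] by simp_all
  show ?thesis
    by (rule tendsto_integral_at[OF m _ assms(2), where w = "\<lambda>x. K * (lin x * E x)"])
       (intro integrable_mult_right integrable_weight \<gamma> K)+
qed

lemma tendsto_u: "((\<lambda>s. u s x) \<longlongrightarrow> u t x) (at t)"
  using has_vector_derivative_continuous[OF time_derivative[of x t]] by (simp add: isCont_def)

text \<open>The momentum density paired with the vector field \<open>b + c x\<close>: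
  \<open>mom b 0\<close> is the component of the momentum along \<open>b\<close>, and
  \<open>mom 0 1\<close> is the virial functional \<open>V\<close>.\<close>

definition mom :: "real^'n \<Rightarrow> real \<Rightarrow> real \<Rightarrow> real" where
  "mom b c t = (LINT x|lborel. (\<Sum>k\<in>UNIV. (b $ k + c * x $ k) * ((\<i> * u t x) \<bullet> du k t x)))"

text \<open>Covers two laws at once: \<open>d = 1\<close>, \<open>b = 0\<close> is conservation of
  mass, and \<open>d = 0\<close>, \<open>b = axis j 1\<close> is the law of the first
  moment.\<close>

lemma weighted_mass_derivative:
  "((\<lambda>t. LINT x|lborel. (d + b \<bullet> x) * (u t x \<bullet> u t x)) has_real_derivative 2 * mom b 0 t) (at t)"
proof -
  have g: "grows (\<lambda>(i::real) x. d + b \<bullet> (x::real^'n))" by (rule grows_affine)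
  have 1: "wdecays (\<lambda>s x. (d + b \<bullet> x) * (2 * (u s x \<bullet> ut s x)))"
    by (intro wdecays_mult g dominated_cmult decays_inner decays_u[of "\<lambda>s. s"] decays_ut[of "\<lambda>s. s"])
  have 2: "wdecays (\<lambda>s x. (d + b \<bullet> x) * (u s x \<bullet> u s x))"
    by (intro wdecays_mult g decays_inner decays_u[of "\<lambda>s. s"])
  obtain K where K: "\<And>s x. norm ((d + b \<bullet> x) * (2 * (u s x \<bullet> ut s x))) \<le> K * (lin x * E x)"
    using 1 unfolding dominated_def by blast
  have "((\<lambda>t. LINT x|lborel. (d + b \<bullet> x) * (u t x \<bullet> u t x)) has_real_derivative
      (LINT x|lborel. (d + b \<bullet> x) * (2 * (u t x \<bullet> ut t x)))) (at t)"
  proof (rule has_derivative_integral_dominated[where g = "\<lambda>x. K * (lin x * E x)" and f' = "\<lambda>s x. (d + b \<bullet> x) * (2 * (u s x \<bullet> ut s x))"])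
    show "((\<lambda>s. (d + b \<bullet> x) * (u s x \<bullet> u s x)) has_real_derivative (d + b \<bullet> x) * (2 * (u s x \<bullet> ut s x))) (at s)" for s x
    proof (intro DERIV_cmult)
      have "((\<lambda>s. u s x) has_derivative (\<lambda>h. h *\<^sub>R ut s x)) (at s)"
        using time_derivative by (simp add: has_vector_derivative_def)
      from has_derivative_inner[OF this this]
      show "((\<lambda>s. u s x \<bullet> u s x) has_real_derivative 2 * (u s x \<bullet> ut s x)) (at s)"
        by (simp add: has_field_derivative_def mult_commute_abs inner_commute algebra_simps)
    qed
    show "integrable lborel (\<lambda>x. K * (lin x * E x))"
      by (intro integrable_mult_right integrable_weight \<gamma>)
    show "integrable lborel (\<lambda>x. (d + b \<bullet> x) * (u s x \<bullet> u s x))" for s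
      using wdecays_integrable[OF 2] .
    show "(\<lambda>x. (d + b \<bullet> x) * (2 * (u t x \<bullet> ut t x))) \<in> borel_measurable lborel"
      using wdecays_integrable[OF 1] by (rule borel_measurable_integrable)
    show "\<bar>(d + b \<bullet> x) * (2 * (u s x \<bullet> ut s x))\<bar> \<le> K * (lin x * E x)" for s x
      using K by simp
  qed
  moreover have "(LINT x|lborel. (d + b \<bullet> x) * (2 * (u t x \<bullet> ut t x))) = 2 * mom b 0 t"
  proof -
    define G where "G k (i::real) x = (d + b \<bullet> x) * ((\<i> * u t x) \<bullet> partial k (du k t) x) + b $ k * ((\<i> * u t x) \<bullet> du k t x)" for k i and x :: "real^'n"
    have wd: "wdecays (\<lambda>(i::real) x. \<Sum>k\<in>UNIV. b $ k * ((\<i> * u t x) \<bullet> du k t x))"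
      by (intro decays_imp_wdecays decays_sum dominated_cmult decays_inner decays_u[of "\<lambda>_. t"] decays_du[of _ "\<lambda>_. t"])
    have G: "(\<Sum>k\<in>UNIV. G k i x) = (\<Sum>k\<in>UNIV. b $ k * ((\<i> * u t x) \<bullet> du k t x)) - (d + b \<bullet> x) * (u t x \<bullet> ut t x)" for i x
    proof -
      \<comment> \<open>The nonlinear term drops out because it is a real multiple of
        \<open>u\<close>, hence orthogonal to \<open>\<i> * u\<close>.\<close>
      have "u t x \<bullet> ut t x = - ((\<i> * u t x) \<bullet> L t x)"
        unfolding equation by (simp add: inner_complex_def algebra_simps)
      then show ?thesis
        unfolding G_def laplacian_def by (simp add: sum.distrib inner_sum_right sum_distrib_left algebra_simps)
    qed
    have wd2: "wdecays (\<lambda>(i::real) x. (d + b \<bullet> x) * (u t x \<bullet> ut t x))"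
      by (intro wdecays_mult g decays_inner decays_u[of "\<lambda>_. t"] decays_ut[of "\<lambda>_. t"])
    have "(LINT x|lborel. (\<Sum>k\<in>UNIV. G k 0 x)) = 0"
    proof (rule integral_divergence[where F = "\<lambda>k i x. (d + b \<bullet> x) * ((\<i> * u t x) \<bullet> du k t x)"])
      fix k
      have w: "has_partial k (\<lambda>x. d + b \<bullet> x) (\<lambda>x. b $ k)"
        unfolding has_partial_def has_real_derivative_iff_has_vector_derivative[symmetric]
          inner_add_right inner_scaleR_right
        by (auto intro!: derivative_eq_intros simp: inner_axis)
      have "has_partial k (\<lambda>x. (d + b \<bullet> x) * ((\<i> * u t x) \<bullet> du k t x))
         (\<lambda>x. (d + b \<bullet> x) * ((\<i> * u t x) \<bullet> partial k (du k t) x + (\<i> * du k t x) \<bullet> du k t x) + b $ k * ((\<i> * u t x) \<bullet> du k t x))"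
        by (intro has_partial_mult w has_partial_inner has_partial_mult_left partials)
      then show "has_partial k (\<lambda>x. (d + b \<bullet> x) * ((\<i> * u t x) \<bullet> du k t x)) (G k 0)"
        unfolding G_def[abs_def] by (simp add: inner_complex_def)
      show "continuous_on UNIV (G k 0)" unfolding G_def by (intro continuous_intros partials)
      show "wdecays (\<lambda>(i::real) x. (d + b \<bullet> x) * ((\<i> * u t x) \<bullet> du k t x))"
        by (intro wdecays_mult g decays_inner dominated_cmult decays_u[of "\<lambda>_. t"] decays_du[of _ "\<lambda>_. t"])
      show "wdecays (\<lambda>i x. \<Sum>k\<in>UNIV. G k i x)"
        unfolding G by (intro dominated_diff wd wd2)
    qed
    then have "(LINT x|lborel. (\<Sum>k\<in>UNIV. b $ k * ((\<i> * u t x) \<bullet> du k t x))) - (LINT x|lborel. (d + b \<bullet> x) * (u t x \<bullet> ut t x)) = 0"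
      unfolding G using wdecays_integrable[OF wd] wdecays_integrable[OF wd2] by simp
    moreover have "(LINT x|lborel. (d + b \<bullet> x) * (2 * (u t x \<bullet> ut t x))) = 2 * (LINT x|lborel. (d + b \<bullet> x) * (u t x \<bullet> ut t x))"
      by (subst integral_mult_right_zero[symmetric]) (simp add: algebra_simps)
    ultimately show ?thesis by (simp add: mom_def)
  qed
  ultimately show ?thesis by simp
qed

text \<open>Expanding both sides leaves the cross terms of times \<open>s\<close> and
  \<open>t\<close>, which form the divergence of
  \<open>(b + c x) ((\<i> * u t x) \<bullet> u s x)\<close>. Without it every term contains
  \<open>u s x - u t x\<close>, so no gradient is differenced in time. The field contributes
  \<open>c\<close> in each direction \<open>k\<close>, hence \<open>c / 2\<close> inside the
  sum.\<close>

lemma mom_difference: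
  "mom b c s - mom b c t = (LINT x|lborel. (\<Sum>k\<in>UNIV. (b $ k + c * x $ k) * ((\<i> * (u s x - u t x)) \<bullet> (du k s x + du k t x))
     + c / 2 * ((\<i> * (u s x - u t x)) \<bullet> (u s x + u t x))))"
proof -
  note dec = decays_u[of "\<lambda>_. t"] decays_u[of "\<lambda>_. s"] decays_du[of _ "\<lambda>_. t"] decays_du[of _ "\<lambda>_. s"]
  define A where "A (i::real) x = (\<Sum>k\<in>UNIV. (b $ k + c * x $ k) * ((\<i> * (u s x - u t x)) \<bullet> (du k s x + du k t x))
     + c / 2 * ((\<i> * (u s x - u t x)) \<bullet> (u s x + u t x)))" for i x
  have A: "wdecays A"
    unfolding A_def[abs_def]
    by (intro wdecays_sum dominated_add[where m = "\<lambda>x. lin x * E x"] wdecays_mult grows_coord decays_imp_wdecays dominated_cmult decays_inner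
         dominated_diff[where m = E] dominated_add[where m = E] dec)
  have M: "wdecays (\<lambda>(i::real) x. \<Sum>k\<in>UNIV. (b $ k + c * x $ k) * ((\<i> * u r x) \<bullet> du k r x))" for r
    by (intro wdecays_sum wdecays_mult grows_coord dominated_cmult decays_inner decays_u[of "\<lambda>_. r"] decays_du[of _ "\<lambda>_. r"])
  define G where "G k (i::real) x = (b $ k + c * x $ k) * ((\<i> * u t x) \<bullet> du k s x + (\<i> * du k t x) \<bullet> u s x) + c * ((\<i> * u t x) \<bullet> u s x)" for k i and x :: "real^'n"
  have G: "G k i x = (b $ k + c * x $ k) * ((\<i> * u s x) \<bullet> du k s x) - (b $ k + c * x $ k) * ((\<i> * u t x) \<bullet> du k t x)
     - ((b $ k + c * x $ k) * ((\<i> * (u s x - u t x)) \<bullet> (du k s x + du k t x))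
     + c / 2 * ((\<i> * (u s x - u t x)) \<bullet> (u s x + u t x)))" for k i x
    unfolding G_def by (simp add: inner_complex_def algebra_simps)
  have GA: "(\<Sum>k\<in>UNIV. G k i x) = (\<Sum>k\<in>UNIV. (b $ k + c * x $ k) * ((\<i> * u s x) \<bullet> du k s x))
      - (\<Sum>k\<in>UNIV. (b $ k + c * x $ k) * ((\<i> * u t x) \<bullet> du k t x)) - A i x" for i x
    unfolding G A_def sum_subtractf ..
  have "(LINT x|lborel. (\<Sum>k\<in>UNIV. G k 0 x)) = 0"
  proof (rule integral_divergence[where F = "\<lambda>k i x. (b $ k + c * x $ k) * ((\<i> * u t x) \<bullet> u s x)"])
    fix k
    have "has_partial k (\<lambda>x. b $ k + c * x $ k) (\<lambda>x. 0 + c * (if k = k then 1 else 0))"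
      by (intro has_partial_add has_partial_const has_partial_mult_left has_partial_component)
    then have w: "has_partial k (\<lambda>x. b $ k + c * x $ k) (\<lambda>x. c)" by simp
    show "has_partial k (\<lambda>x. (b $ k + c * x $ k) * ((\<i> * u t x) \<bullet> u s x)) (G k 0)"
      unfolding G_def[abs_def] by (intro has_partial_mult w has_partial_inner has_partial_mult_left partials)
    show "continuous_on UNIV (G k 0)" unfolding G_def by (intro continuous_intros partials)
    show "wdecays (\<lambda>(i::real) x. (b $ k + c * x $ k) * ((\<i> * u t x) \<bullet> u s x))"
      by (intro wdecays_mult grows_coord decays_inner dominated_cmult dec)
    show "wdecays (\<lambda>i x. \<Sum>k\<in>UNIV. G k i x)"
      unfolding GA by (intro dominated_diff M A)
  qed
  then have "mom b c s - mom b c t = (LINT x|lborel. A 0 x)"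
    unfolding GA mom_def using wdecays_integrable[OF A] wdecays_integrable[OF M] by simp
  then show ?thesis unfolding A_def .
qed

text \<open>After division of \<open>mom_difference\<close> by \<open>s - t\<close> the quotient
  acts on \<open>u\<close> alone, so pointwise limits of \<open>quot\<close> and of the gradient
  suffice.\<close>

lemma mom_derivative_aux:
  "(mom b c has_real_derivative (LINT x|lborel. (\<Sum>k\<in>UNIV. (b $ k + c * x $ k) * ((\<i> * ut t x) \<bullet> (du k t x + du k t x))
     + c / 2 * ((\<i> * ut t x) \<bullet> (u t x + u t x))))) (at t)"
proof -
  have "((\<lambda>s. LINT x|lborel. (\<Sum>k\<in>UNIV. (b $ k + c * x $ k) * ((\<i> * quot t s x) \<bullet> (du k s x + du k t x))
     + c / 2 * ((\<i> * quot t s x) \<bullet> (u s x + u t x)))) \<longlongrightarrow>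
     (LINT x|lborel. (\<Sum>k\<in>UNIV. (b $ k + c * x $ k) * ((\<i> * ut t x) \<bullet> (du k t x + du k t x))
     + c / 2 * ((\<i> * ut t x) \<bullet> (u t x + u t x))))) (at t)"
  proof (rule integral_tendsto_at)
    show "wdecays (\<lambda>s x. (\<Sum>k\<in>UNIV. (b $ k + c * x $ k) * ((\<i> * quot t s x) \<bullet> (du k s x + du k t x))
     + c / 2 * ((\<i> * quot t s x) \<bullet> (u s x + u t x))))"
      by (intro wdecays_sum dominated_add[where m = "\<lambda>x. lin x * E x"] wdecays_mult grows_coord decays_imp_wdecays dominated_cmult decays_inner
         dominated_add[where m = E] decays_u[of "\<lambda>s. s"] decays_u[of "\<lambda>s. t"] decays_du[of _ "\<lambda>s. s"] decays_du[of _ "\<lambda>s. t"] decays_quot[of _ "\<lambda>s. s"])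
    show "((\<lambda>s. (\<Sum>k\<in>UNIV. (b $ k + c * x $ k) * ((\<i> * quot t s x) \<bullet> (du k s x + du k t x))
     + c / 2 * ((\<i> * quot t s x) \<bullet> (u s x + u t x)))) \<longlongrightarrow> (\<Sum>k\<in>UNIV. (b $ k + c * x $ k) * ((\<i> * ut t x) \<bullet> (du k t x + du k t x))
     + c / 2 * ((\<i> * ut t x) \<bullet> (u t x + u t x)))) (at t)" for x
      by (intro tendsto_intros quot_tendsto tendsto_u gradient_tendsto)
    show "continuous_on UNIV (\<lambda>x. (\<Sum>k\<in>UNIV. (b $ k + c * x $ k) * ((\<i> * ut t x) \<bullet> (du k t x + du k t x))
     + c / 2 * ((\<i> * ut t x) \<bullet> (u t x + u t x))))"
      by (intro continuous_intros partials dominated_cont[OF decays_ut[of "\<lambda>_::unit. t"]])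
  qed
  moreover have "(LINT x|lborel. (\<Sum>k\<in>UNIV. (b $ k + c * x $ k) * ((\<i> * quot t s x) \<bullet> (du k s x + du k t x))
     + c / 2 * ((\<i> * quot t s x) \<bullet> (u s x + u t x)))) = (mom b c s - mom b c t) / (s - t)" for s
  proof -
    have q: "(\<i> * quot t s x) \<bullet> v = ((\<i> * (u s x - u t x)) \<bullet> v) / (s - t)" for x v
      by (simp add: quot_def divide_inverse mult.commute)
    have "(\<Sum>k\<in>UNIV. (b $ k + c * x $ k) * ((\<i> * quot t s x) \<bullet> (du k s x + du k t x))
       + c / 2 * ((\<i> * quot t s x) \<bullet> (u s x + u t x)))
     = (\<Sum>k\<in>UNIV. (b $ k + c * x $ k) * ((\<i> * (u s x - u t x)) \<bullet> (du k s x + du k t x))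
       + c / 2 * ((\<i> * (u s x - u t x)) \<bullet> (u s x + u t x))) / (s - t)" for x
      unfolding q by (simp add: sum_divide_distrib add_divide_distrib)
    then show ?thesis unfolding mom_difference by simp
  qed
  ultimately show ?thesis by (simp add: has_field_derivative_iff)
qed

section \<open>The Pohozaev identity and the virial law\<close>

definition kinetic :: "real \<Rightarrow> real" where
  "kinetic t = (LINT x|lborel. (\<Sum>k\<in>UNIV. du k t x \<bullet> du k t x))"

definition potential :: "real \<Rightarrow> real" where
  "potential t = (LINT x|lborel. norm (u t x) powr (p + 2))"

lemma powr_p2: "norm (u t x) powr (p + 2) = \<phi> t x \<bullet> u t x"
proof -
  have "norm (u t x) powr (p + 2) = norm (u t x) powr p * (norm (u t x))\<^sup>2"
    by (cases "u t x = 0") (simp_all add: powr_add)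
  also have "(norm (u t x))\<^sup>2 = u t x \<bullet> u t x" by (simp add: power2_norm_eq_inner)
  finally show ?thesis by (simp add: scaleR_conv_of_real[symmetric])
qed

lemma decays_potential: "decays (\<lambda>i x. norm (u (\<tau> i) x) powr (p + 2))"
  unfolding powr_p2 by (intro decays_inner decays_\<phi> decays_u)

lemma decays_kinetic: "decays (\<lambda>i x. \<Sum>k\<in>UNIV. du k (\<tau> i) x \<bullet> du k (\<sigma> i) x)"
  by (intro decays_sum decays_inner decays_du)

text \<open>Summing \<open>c / 2\<close> over \<open>k\<close> completes the multiplier to
  \<open>(b + c x) . grad u + (n c / 2) u\<close>. Its product with
  \<open>L t x + \<phi> t x\<close> is a divergence up to kinetic and potential densities. The right
  side is free of \<open>b\<close> because translations preserve both.\<close>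

lemma pohozaev:
  "(LINT x|lborel. (\<Sum>k\<in>UNIV. (b $ k + c * x $ k) * ((L t x + \<phi> t x) \<bullet> du k t x)
     + c / 2 * ((L t x + \<phi> t x) \<bullet> u t x)))
   = - c * kinetic t + real CARD('n) * c * p / (2 * (p + 2)) * potential t"
proof -
  let ?n = "real CARD('n)"
  note dec = decays_u[of "\<lambda>_. t"] decays_du[of _ "\<lambda>_. t"] decays_\<phi>[of "\<lambda>_. t"] decays_L[of "\<lambda>_. t"]
  define a where "a k x = b $ k + c * x $ k" for k and x :: "real^'n"
  have ga: "grows (\<lambda>(i::real). a k)" for k unfolding a_def by (rule grows_coord)
  have pa: "has_partial k (a j) (\<lambda>x. if j = k then c else 0)" for j k
  proof -
    have "has_partial k (a j) (\<lambda>x. 0 + c * (if j = k then 1 else 0))"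
      unfolding a_def by (intro has_partial_add has_partial_const has_partial_mult_left has_partial_component)
    then show ?thesis by (simp add: if_distrib cong: if_cong)
  qed
  define h where "h k j = partial k (du j t)" for k j
  have ph: "has_partial k (du j t) (h k j)" for j k unfolding h_def by (rule partials)
  have ch: "continuous_on UNIV (h k j)" for j k unfolding h_def by (rule partials)
  have ca: "continuous_on UNIV (a k)" for k unfolding a_def by (intro continuous_intros)
  \<comment> \<open>Symmetry makes the term \<open>?S\<close> below occur twice with opposite signs,
    so the second partials that lack decay disappear and only the Laplacian is left.\<close>
  have sym: "h k j = h j k" for j k
    by (rule ext, rule mixed_partials_commute[OF partials(1) ph partials(1) ph ch ch])
  have Lh: "L t x = (\<Sum>k\<in>UNIV. h k k x)" for x by (simp add: laplacian_def h_def)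
  \<comment> \<open>The stress tensor contracted with the field \<open>a\<close>, plus the flux of
    \<open>u \<bullet> grad u\<close>. The factor \<open>?n * c / 2\<close> of the latter cancels
    the kinetic terms that carry the dimension, leaving \<open>c\<close> times the kinetic
    density.\<close>
  define F where "F k (i::real) x = (\<Sum>j\<in>UNIV. a j x * (du k t x \<bullet> du j t x)) - a k x * (1 / 2 * (\<Sum>j\<in>UNIV. du j t x \<bullet> du j t x))
     + ?n * c / 2 * (u t x \<bullet> du k t x) + a k x * (1 / (p + 2) * norm (u t x) powr (p + 2))" for k i x
  define G where "G k (i::real) x =
     (\<Sum>j\<in>UNIV. a j x * (du k t x \<bullet> h k j x + h k k x \<bullet> du j t x) + (if j = k then c else 0) * (du k t x \<bullet> du j t x))
     - (a k x * (1 / 2 * (\<Sum>j\<in>UNIV. du j t x \<bullet> h k j x + h k j x \<bullet> du j t x)) + c * (1 / 2 * (\<Sum>j\<in>UNIV. du j t x \<bullet> du j t x)))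
     + ?n * c / 2 * (u t x \<bullet> h k k x + du k t x \<bullet> du k t x)
     + (a k x * (1 / (p + 2) * ((p + 2) * norm (u t x) powr p * (u t x \<bullet> du k t x))) + c * (1 / (p + 2) * norm (u t x) powr (p + 2)))" for k i x
  have FG: "has_partial k (F k i) (G k i)" for k i
  proof -
    have "has_partial k (F k i) (\<lambda>x.
     (\<Sum>j\<in>UNIV. a j x * (du k t x \<bullet> h k j x + h k k x \<bullet> du j t x) + (if j = k then c else 0) * (du k t x \<bullet> du j t x))
     - (a k x * (1 / 2 * (\<Sum>j\<in>UNIV. du j t x \<bullet> h k j x + h k j x \<bullet> du j t x)) + (if k = k then c else 0) * (1 / 2 * (\<Sum>j\<in>UNIV. du j t x \<bullet> du j t x)))
     + ?n * c / 2 * (u t x \<bullet> h k k x + du k t x \<bullet> du k t x)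
     + (a k x * (1 / (p + 2) * ((p + 2) * norm (u t x) powr p * (u t x \<bullet> du k t x))) + (if k = k then c else 0) * (1 / (p + 2) * norm (u t x) powr (p + 2))))"
      unfolding F_def
      by (intro has_partial_add has_partial_diff has_partial_sum has_partial_mult[OF pa] has_partial_mult_left
          has_partial_inner has_partial_norm_powr p ph partials(1))
    then show ?thesis unfolding G_def by simp
  qed
  have cG: "continuous_on UNIV (G k i)" for k i
  proof -
    have pw: "continuous_on UNIV (\<lambda>x. norm (u t x) powr q)" if "0 < q" for q
      by (rule continuous_on_powr'[OF continuous_on_norm[OF partials(3)] continuous_on_const]) (use that in auto)
    have "0 < p + 2" using p by simp
    then show ?thesis
      unfolding G_def
      by (intro continuous_on_add continuous_on_diff continuous_on_sum continuous_on_mult continuous_on_inner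
          continuous_on_const pw p ca ch partials)
  qed
  have dF: "wdecays (F k)" for k
    unfolding F_def
    by (intro dominated_add[where m = "\<lambda>x. lin x * E x"] dominated_diff[where m = "\<lambda>x. lin x * E x"] wdecays_sum
          wdecays_mult ga dominated_cmult[where m = E] decays_imp_wdecays decays_sum decays_inner dec decays_potential[of "\<lambda>_. t"])
  define M where "M (i::real) x = (\<Sum>k\<in>UNIV. a k x * ((L t x + \<phi> t x) \<bullet> du k t x) + c / 2 * ((L t x + \<phi> t x) \<bullet> u t x))" for i x
  have dM: "wdecays M"
    unfolding M_def
    by (intro dominated_add[where m = "\<lambda>x. lin x * E x"] wdecays_sum
          wdecays_mult ga dominated_cmult[where m = E] dominated_add[where m = E] decays_imp_wdecays decays_inner dec)
  \<comment> \<open>This is \<open>?n * c / 2 - ?n * c / (p + 2)\<close>: the first part comes from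
    the multiplier, the second from the divergence of the potential flux.\<close>
  define \<kappa> where "\<kappa> = ?n * c * p / (2 * (p + 2))"
  have GM: "(\<Sum>k\<in>UNIV. G k i x) = M i x + c * (\<Sum>k\<in>UNIV. du k t x \<bullet> du k t x) - \<kappa> * norm (u t x) powr (p + 2)" for i x
  proof -
    let ?K = "\<Sum>k\<in>UNIV. du k t x \<bullet> du k t x"
    let ?N = "norm (u t x) powr (p + 2)"
    let ?S = "\<Sum>k\<in>UNIV. \<Sum>j\<in>UNIV. a k x * (du j t x \<bullet> h k j x)"
    have s1: "(\<Sum>k\<in>UNIV. \<Sum>j\<in>UNIV. a j x * (du k t x \<bullet> h k j x)) = ?S"
      by (subst sum.swap) (simp add: sym)
    have s2: "(\<Sum>k\<in>UNIV. \<Sum>j\<in>UNIV. a j x * (h k k x \<bullet> du j t x)) = (\<Sum>j\<in>UNIV. a j x * (L t x \<bullet> du j t x))"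
      by (subst sum.swap) (simp add: Lh inner_sum_left sum_distrib_left)
    have s3: "(\<Sum>k\<in>UNIV. \<Sum>j\<in>UNIV. (if j = k then c else 0) * (du k t x \<bullet> du j t x)) = c * ?K"
      by (simp add: if_distrib[of "\<lambda>r. r * _"] sum_distrib_left cong: if_cong)
    have s4: "(\<Sum>k\<in>UNIV. a k x * (1 / 2 * (\<Sum>j\<in>UNIV. du j t x \<bullet> h k j x + h k j x \<bullet> du j t x))) = ?S"
      by (simp add: inner_commute[of "h _ _ x"] sum_distrib_left sum_distrib_right mult.assoc[symmetric])
    have s5: "(\<Sum>k\<in>UNIV. a k x * (1 / (p + 2) * ((p + 2) * norm (u t x) powr p * (u t x \<bullet> du k t x)))) = (\<Sum>k\<in>UNIV. a k x * (\<phi> t x \<bullet> du k t x))"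
      using p by (simp add: scaleR_conv_of_real[symmetric])
    have s6: "(\<Sum>k\<in>UNIV. u t x \<bullet> h k k x) = L t x \<bullet> u t x"
      unfolding inner_commute[of "L t x"] by (simp add: Lh inner_sum_right)
    have s7: "(\<Sum>k\<in>UNIV. \<Sum>j\<in>UNIV. a j x * (du k t x \<bullet> h k j x + h k k x \<bullet> du j t x) + (if j = k then c else 0) * (du k t x \<bullet> du j t x))
        = ?S + (\<Sum>k\<in>UNIV. a k x * (L t x \<bullet> du k t x)) + c * ?K"
      unfolding sum.distrib distrib_left s1 s2 s3 ..
    have s8: "(\<Sum>k\<in>UNIV. ?n * c / 2 * (u t x \<bullet> h k k x + du k t x \<bullet> du k t x)) = ?n * c / 2 * (L t x \<bullet> u t x + ?K)"
      unfolding sum_distrib_left[symmetric] sum.distrib s6 ..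
    have split: "(\<Sum>k\<in>UNIV. f k - (g k + r) + v k + (w k + y)) = sum f UNIV - (sum g UNIV + ?n * r) + sum v UNIV + (sum w UNIV + ?n * y)"
      for f g v w :: "'n \<Rightarrow> real" and r y
      by (simp add: sum.distrib sum_subtractf)
    have "(\<Sum>k\<in>UNIV. G k i x) = ?S + (\<Sum>k\<in>UNIV. a k x * (L t x \<bullet> du k t x)) + c * ?K - (?S + ?n * (c * (1 / 2 * ?K)))
        + ?n * c / 2 * (L t x \<bullet> u t x + ?K) + ((\<Sum>k\<in>UNIV. a k x * (\<phi> t x \<bullet> du k t x)) + ?n * (c * (1 / (p + 2) * ?N)))"
      unfolding G_def split s4 s5 s7 s8 ..
    also have "\<dots> = (\<Sum>k\<in>UNIV. a k x * ((L t x + \<phi> t x) \<bullet> du k t x)) + ?n * c / 2 * (L t x \<bullet> u t x) + ?n * c / (p + 2) * ?N + c * ?K"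
      by (simp add: inner_add_left distrib_left sum.distrib)
    also have "\<dots> = M i x + c * ?K - ?n * c / 2 * ?N + ?n * c / (p + 2) * ?N"
      unfolding M_def sum.distrib powr_p2 by (simp add: inner_add_left algebra_simps)
    also have "\<dots> = M i x + c * ?K - \<kappa> * ?N"
    proof -
      have "?n * c / 2 - ?n * c / (p + 2) = \<kappa>" using p by (simp add: \<kappa>_def field_simps)
      then have "?n * c / 2 * ?N - ?n * c / (p + 2) * ?N = \<kappa> * ?N" by (metis left_diff_distrib)
      then show ?thesis by simp
    qed
    finally show ?thesis .
  qed
  have dK: "wdecays (\<lambda>(i::real) x. c * (\<Sum>k\<in>UNIV. du k t x \<bullet> du k t x))"
    by (intro decays_imp_wdecays dominated_cmult decays_kinetic[of "\<lambda>_. t" "\<lambda>_. t"])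
  have dN: "wdecays (\<lambda>(i::real) x. \<kappa> * norm (u t x) powr (p + 2))"
    by (intro decays_imp_wdecays dominated_cmult decays_potential[of "\<lambda>_. t"])
  have "(LINT x|lborel. (\<Sum>k\<in>UNIV. G k 0 x)) = 0"
    by (rule integral_divergence[OF FG cG dF]) (unfold GM, intro dominated_add dominated_diff dM dK dN)
  then have "(LINT x|lborel. M 0 x) + c * kinetic t - \<kappa> * potential t = 0"
    unfolding GM using wdecays_integrable[OF dM] wdecays_integrable[OF dK] wdecays_integrable[OF dN]
    by (simp add: kinetic_def potential_def)
  then show ?thesis unfolding M_def a_def \<kappa>_def by simp
qed

text \<open>The factor -2 relative to \<open>pohozaev\<close> combines
  \<open>\<i> * ut t x = - (L t x + \<phi> t x)\<close> with the doubled arguments of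
  \<open>mom_derivative_aux\<close>. For \<open>c = 0\<close> this is conservation of
  momentum.\<close>

lemma mom_derivative:
  "(mom b c has_real_derivative 2 * c * kinetic t - real CARD('n) * c * p / (p + 2) * potential t) (at t)"
proof -
  have i: "\<i> * ut t x = - (L t x + \<phi> t x)" for x by (simp add: equation algebra_simps)
  have alg: "a * (- w \<bullet> (v + v)) + c / 2 * (- w \<bullet> (y + y)) = (- 2) * (a * (w \<bullet> v) + c / 2 * (w \<bullet> y))"
    for a and v w y :: complex
    by (simp add: inner_complex_def algebra_simps)
  have "(LINT x|lborel. (\<Sum>k\<in>UNIV. (b $ k + c * x $ k) * ((\<i> * ut t x) \<bullet> (du k t x + du k t x))
     + c / 2 * ((\<i> * ut t x) \<bullet> (u t x + u t x))))
    = (LINT x|lborel. (- 2) * (\<Sum>k\<in>UNIV. (b $ k + c * x $ k) * ((L t x + \<phi> t x) \<bullet> du k t x)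
     + c / 2 * ((L t x + \<phi> t x) \<bullet> u t x)))"
    unfolding i sum_distrib_left alg ..
  also have "\<dots> = (- 2) * (- c * kinetic t + real CARD('n) * c * p / (2 * (p + 2)) * potential t)"
    by (simp only: integral_mult_right_zero pohozaev)
  also have "\<dots> = 2 * c * kinetic t - real CARD('n) * c * p / (p + 2) * potential t"
    using p by (simp add: field_simps)
  finally show ?thesis using mom_derivative_aux[of b c t] by simp
qed

subsection \<open>Conservation of energy\<close>

text \<open>The polarized kinetic energy. Changing one argument at a time lets \<open>green\<close>
  rewrite each change as a pairing of \<open>u s x - u t x\<close> with a Laplacian.\<close>

definition gram :: "real \<Rightarrow> real \<Rightarrow> real" where
  "gram s t = (LINT x|lborel. (\<Sum>k\<in>UNIV. du k s x \<bullet> du k t x))"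

lemma gram_commute: "gram s t = gram t s"
  by (simp add: gram_def inner_commute)

lemma green: "(LINT x|lborel. u s x \<bullet> L t x) = - gram s t"
proof -
  have d1: "wdecays (\<lambda>(i::real) x. u s x \<bullet> L t x)"
    by (intro decays_imp_wdecays decays_inner decays_u[of "\<lambda>_. s"] decays_L[of "\<lambda>_. t"])
  have d2: "wdecays (\<lambda>(i::real) x. \<Sum>k\<in>UNIV. du k s x \<bullet> du k t x)"
    by (intro decays_imp_wdecays decays_kinetic[of "\<lambda>_. s" "\<lambda>_. t"])
  have eq: "(\<Sum>k\<in>UNIV. u s x \<bullet> partial k (du k t) x + du k s x \<bullet> du k t x)
     = u s x \<bullet> L t x + (\<Sum>k\<in>UNIV. du k s x \<bullet> du k t x)" for x
    by (simp add: sum.distrib laplacian_def inner_sum_right)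
  have "(LINT x|lborel. (\<Sum>k\<in>UNIV. u s x \<bullet> partial k (du k t) x + du k s x \<bullet> du k t x)) = 0"
  proof (rule integral_divergence[where F = "\<lambda>k (i::real) x. u s x \<bullet> du k t x" and i = 0])
    show "has_partial k (\<lambda>x. u s x \<bullet> du k t x) (\<lambda>x. u s x \<bullet> partial k (du k t) x + du k s x \<bullet> du k t x)" for k
      by (intro has_partial_inner partials)
    show "continuous_on UNIV (\<lambda>x. u s x \<bullet> partial k (du k t) x + du k s x \<bullet> du k t x)" for k
      by (intro continuous_intros partials)
    show "wdecays (\<lambda>(i::real) x. u s x \<bullet> du k t x)" for k
      by (intro decays_imp_wdecays decays_inner decays_u[of "\<lambda>_. s"] decays_du[of _ "\<lambda>_. t"])
    show "wdecays (\<lambda>(i::real) x. \<Sum>k\<in>UNIV. u s x \<bullet> partial k (du k t) x + du k s x \<bullet> du k t x)"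
      unfolding eq by (intro dominated_add d1 d2)
  qed
  then show ?thesis
    unfolding eq gram_def using wdecays_integrable[OF d1] wdecays_integrable[OF d2] by simp
qed

lemma gram_tendsto: "((\<lambda>r. gram s r) \<longlongrightarrow> gram s t) (at t)"
  unfolding gram_def
  by (rule integral_tendsto_at)
     (intro decays_imp_wdecays decays_kinetic[of "\<lambda>_. s" "\<lambda>r. r"] tendsto_intros gradient_tendsto continuous_intros partials)+

lemma integrable_u_L: "integrable lborel (\<lambda>x. u s x \<bullet> L t x)"
  using decays_integrable[OF decays_inner[OF decays_u[of "\<lambda>_::unit. s"] decays_L[of "\<lambda>_. t"]]] by simp

lemma integrable_ut_L: "integrable lborel (\<lambda>x. ut s x \<bullet> L t x)"
  using decays_integrable[OF decays_inner[OF decays_ut[of "\<lambda>_::unit. s"] decays_L[of "\<lambda>_. t"]]] by simp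

lemma integrable_quot_L: "integrable lborel (\<lambda>x. quot t s x \<bullet> L r x)"
  using decays_integrable[OF decays_inner[OF decays_quot[of t "\<lambda>_::unit. s"] decays_L[of "\<lambda>_. r"]]] by simp

lemma integral_quot_L: "(LINT x|lborel. quot t s x \<bullet> L r x) = (gram t r - gram s r) / (s - t)"
proof -
  have "quot t s x \<bullet> L r x = (u s x \<bullet> L r x - u t x \<bullet> L r x) / (s - t)" for x
    by (simp add: quot_def inner_diff_left divide_inverse mult.commute)
  then show ?thesis using integrable_u_L by (simp add: green)
qed

text \<open>Since \<open>L s\<close> need not converge pointwise as \<open>s \<rightarrow> t\<close>, the limit is first taken against
  a difference quotient in place of \<open>ut t\<close>, where Green's identity moves a derivative away from \<open>L\<close>.\<close>

lemma ut_laplacian_tendsto: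
  "((\<lambda>s. LINT x|lborel. ut t x \<bullet> L s x) \<longlongrightarrow> (LINT x|lborel. ut t x \<bullet> L t x)) (at t)"
proof (rule LIM_zero_cancel, rule tendstoI)
  fix e :: real assume e: "0 < e"
  note dec = decays_ut[of "\<lambda>_. t"] decays_L[of "\<lambda>_. t"] decays_L[of "\<lambda>s. s"]
  obtain M where M: "0 \<le> M" "\<And>s x. norm (L s x) \<le> M * E x"
    using dominated_bound[OF decays_L[of "\<lambda>s. s"]] by (metis exp_ge_zero)
  have M1: "norm (L s x - L t x) \<le> 2 * M" for s x
  proof -
    have "M * E x \<le> M * 1" by (intro mult_left_mono E_le_1 M)
    then show ?thesis using norm_triangle_ineq4[of "L s x" "L t x"] M(2)[of s x] M(2)[of t x] by linarith
  qed
  have dq: "decays (\<lambda>\<tau> x. quot t \<tau> x - ut t x)"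
    by (intro dominated_diff decays_quot[of _ "\<lambda>s. s"] dec)
  have dn: "decays (\<lambda>\<tau> x. norm (quot t \<tau> x - ut t x))"
    using dq unfolding dominated_def by (auto intro!: continuous_on_norm)
  have "((\<lambda>\<tau>. LINT x|lborel. norm (quot t \<tau> x - ut t x)) \<longlongrightarrow> (LINT x|(lborel :: (real^'n) measure). 0)) (at t)"
  proof (rule integral_tendsto_at)
    show "((\<lambda>\<tau>. norm (quot t \<tau> x - ut t x)) \<longlongrightarrow> 0) (at t)" for x
      by (intro tendsto_norm_zero LIM_zero quot_tendsto)
    show "wdecays (\<lambda>\<tau> x. norm (quot t \<tau> x - ut t x))"
      by (rule decays_imp_wdecays[OF dn])
  qed simp
  then have "((\<lambda>\<tau>. 2 * M * (LINT x|lborel. norm (quot t \<tau> x - ut t x))) \<longlongrightarrow> 2 * M * 0) (at t)"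
    by (intro tendsto_intros) simp
  then have "eventually (\<lambda>\<tau>. 2 * M * (LINT x|lborel. norm (quot t \<tau> x - ut t x)) < e / 2) (at t)"
    using e by (intro order_tendstoD(2)) auto
  \<comment> \<open>\<open>\<tau>\<close> is fixed before \<open>s\<close>: replacing
    \<open>ut t\<close> by \<open>quot t \<tau>\<close> costs less than \<open>e / 2\<close> for all
    \<open>s\<close> at once, since \<open>L s x - L t x\<close> is bounded uniformly.\<close>
  then obtain \<tau> where \<tau>: "2 * M * (LINT x|lborel. norm (quot t \<tau> x - ut t x)) < e / 2"
    using eventually_happens by fastforce
  \<comment> \<open>Nothing excludes \<open>\<tau> = t\<close>, but then both quotients are 0 by the
    convention for division.\<close>
  have "((\<lambda>s. (gram t s - gram \<tau> s) / (\<tau> - t) - (gram t t - gram \<tau> t) / (\<tau> - t)) \<longlongrightarrow> 0) (at t)"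
    by (cases "\<tau> = t") (auto intro!: LIM_zero tendsto_divide tendsto_diff gram_tendsto tendsto_const)
  then have "eventually (\<lambda>s. dist ((gram t s - gram \<tau> s) / (\<tau> - t) - (gram t t - gram \<tau> t) / (\<tau> - t)) 0 < e / 2) (at t)"
    using e by (intro tendstoD) auto
  then show "eventually (\<lambda>s. dist ((LINT x|lborel. ut t x \<bullet> L s x) - (LINT x|lborel. ut t x \<bullet> L t x)) 0 < e) (at t)"
  proof (rule eventually_mono)
    fix s
    assume s: "dist ((gram t s - gram \<tau> s) / (\<tau> - t) - (gram t t - gram \<tau> t) / (\<tau> - t)) 0 < e / 2"
    have eq: "(LINT x|lborel. ut t x \<bullet> L s x) - (LINT x|lborel. ut t x \<bullet> L t x)
      = ((gram t s - gram \<tau> s) / (\<tau> - t) - (gram t t - gram \<tau> t) / (\<tau> - t))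
        - (LINT x|lborel. (quot t \<tau> x - ut t x) \<bullet> (L s x - L t x))"
      unfolding integral_quot_L[symmetric] inner_diff_left inner_diff_right using integrable_ut_L integrable_quot_L by simp
    have "norm (LINT x|lborel. (quot t \<tau> x - ut t x) \<bullet> (L s x - L t x)) \<le> (LINT x|lborel. 2 * M * norm (quot t \<tau> x - ut t x))"
    proof (rule Bochner_Integration.integral_norm_bound_integral)
      show "integrable lborel (\<lambda>x. (quot t \<tau> x - ut t x) \<bullet> (L s x - L t x))"
        unfolding inner_diff_left inner_diff_right using integrable_ut_L integrable_quot_L by simp
      show "integrable lborel (\<lambda>x. 2 * M * norm (quot t \<tau> x - ut t x))"
        by (intro integrable_mult_right decays_integrable[OF dn])
      show "norm ((quot t \<tau> x - ut t x) \<bullet> (L s x - L t x)) \<le> 2 * M * norm (quot t \<tau> x - ut t x)" for x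
      proof -
        have "norm ((quot t \<tau> x - ut t x) \<bullet> (L s x - L t x)) \<le> norm (quot t \<tau> x - ut t x) * norm (L s x - L t x)"
          by (simp add: Cauchy_Schwarz_ineq2)
        also have "\<dots> \<le> norm (quot t \<tau> x - ut t x) * (2 * M)"
          by (intro mult_left_mono M1) simp
        finally show ?thesis by (simp add: mult.commute)
      qed
    qed
    also have "\<dots> = 2 * M * (LINT x|lborel. norm (quot t \<tau> x - ut t x))" by simp
    finally show "dist ((LINT x|lborel. ut t x \<bullet> L s x) - (LINT x|lborel. ut t x \<bullet> L t x)) 0 < e"
      unfolding eq using s \<tau> unfolding dist_real_def real_norm_def by linarith
  qed
qed

lemma kinetic_derivative:
  "(kinetic has_real_derivative - 2 * (LINT x|lborel. ut t x \<bullet> L t x)) (at t)"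
proof -
  \<comment> \<open>In the first term \<open>quot t s x - ut t x\<close> tends to 0 while
    \<open>L s\<close> is merely bounded; the second is the limit just proved; in the third the
    Laplacian is fixed.\<close>
  have K: "(kinetic s - kinetic t) / (s - t) = - (LINT x|lborel. (quot t s x - ut t x) \<bullet> L s x)
      - (LINT x|lborel. ut t x \<bullet> L s x) - (LINT x|lborel. quot t s x \<bullet> L t x)" for s
  proof -
    have "kinetic r = gram r r" for r by (simp add: kinetic_def gram_def)
    then have "(kinetic s - kinetic t) / (s - t) = - ((gram t s - gram s s) / (s - t)) - (gram t t - gram s t) / (s - t)"
      using gram_commute[of s t] by (simp add: diff_divide_distrib)
    also have "\<dots> = - (LINT x|lborel. quot t s x \<bullet> L s x) - (LINT x|lborel. quot t s x \<bullet> L t x)"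
      by (simp add: integral_quot_L)
    also have "(LINT x|lborel. quot t s x \<bullet> L s x) = (LINT x|lborel. (quot t s x - ut t x) \<bullet> L s x) + (LINT x|lborel. ut t x \<bullet> L s x)"
      unfolding inner_diff_left using integrable_ut_L integrable_quot_L by simp
    finally show ?thesis by simp
  qed
  have A: "((\<lambda>s. LINT x|lborel. quot t s x \<bullet> L t x) \<longlongrightarrow> (LINT x|lborel. ut t x \<bullet> L t x)) (at t)"
    by (rule integral_tendsto_at)
       (intro decays_imp_wdecays decays_inner decays_quot[of _ "\<lambda>s. s"] decays_L[of "\<lambda>_. t"] tendsto_intros quot_tendsto
         continuous_intros dominated_cont[OF decays_ut[of "\<lambda>_::unit. t"]] continuous_L)+
  have B: "((\<lambda>s. LINT x|lborel. (quot t s x - ut t x) \<bullet> L s x) \<longlongrightarrow> (LINT x|(lborel :: (real^'n) measure). 0)) (at t)"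
  proof (rule integral_tendsto_at)
    show "wdecays (\<lambda>s x. (quot t s x - ut t x) \<bullet> L s x)"
      by (intro decays_imp_wdecays decays_inner dominated_diff decays_quot[of _ "\<lambda>s. s"] decays_ut[of "\<lambda>_. t"] decays_L[of "\<lambda>s. s"])
    show "((\<lambda>s. (quot t s x - ut t x) \<bullet> L s x) \<longlongrightarrow> 0) (at t)" for x
    proof -
      obtain M where M: "\<And>s x. norm (L s x) \<le> M * E x"
        using decays_L[of "\<lambda>s::real. s"] unfolding dominated_def by blast
      show ?thesis
      proof (rule Lim_null_comparison)
      show "\<forall>\<^sub>F s in at t. norm ((quot t s x - ut t x) \<bullet> L s x) \<le> norm (quot t s x - ut t x) * (M * E x)"
      proof (intro always_eventually allI)
        fix s
        have "norm ((quot t s x - ut t x) \<bullet> L s x) \<le> norm (quot t s x - ut t x) * norm (L s x)"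
          by (simp add: Cauchy_Schwarz_ineq2)
        also have "\<dots> \<le> norm (quot t s x - ut t x) * (M * E x)"
          by (intro mult_left_mono M) simp
        finally show "norm ((quot t s x - ut t x) \<bullet> L s x) \<le> \<dots>" .
      qed
      show "((\<lambda>s. norm (quot t s x - ut t x) * (M * E x)) \<longlongrightarrow> 0) (at t)"
        by (intro tendsto_mult_left_zero tendsto_norm_zero LIM_zero quot_tendsto)
      qed
    qed
  qed auto
  have "((\<lambda>s. (kinetic s - kinetic t) / (s - t)) \<longlongrightarrow> - (LINT x|(lborel::(real^'n) measure). 0) - (LINT x|lborel. ut t x \<bullet> L t x) - (LINT x|lborel. ut t x \<bullet> L t x)) (at t)"
    unfolding K by (intro tendsto_intros A B ut_laplacian_tendsto)
  then show ?thesis by (simp add: has_field_derivative_iff)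
qed

lemma potential_derivative:
  "(potential has_real_derivative (p + 2) * (LINT x|lborel. \<phi> t x \<bullet> ut t x)) (at t)"
proof -
  have d: "wdecays (\<lambda>s x. (p + 2) * (\<phi> s x \<bullet> ut s x))"
    by (intro decays_imp_wdecays dominated_cmult decays_inner decays_\<phi>[of "\<lambda>s. s"] decays_ut[of "\<lambda>s. s"])
  obtain K where K: "\<And>s x. norm ((p + 2) * (\<phi> s x \<bullet> ut s x)) \<le> K * (lin x * E x)"
    using d unfolding dominated_def by blast
  have "(potential has_real_derivative (LINT x|lborel. (p + 2) * (\<phi> t x \<bullet> ut t x))) (at t)"
    unfolding potential_def[abs_def]
  proof (rule has_derivative_integral_dominated[where g = "\<lambda>x. K * (lin x * E x)" and f' = "\<lambda>s x. (p + 2) * (\<phi> s x \<bullet> ut s x)"])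
    show "((\<lambda>s. norm (u s x) powr (p + 2)) has_real_derivative (p + 2) * (\<phi> s x \<bullet> ut s x)) (at s)" for s x
      using has_real_derivative_norm_powr[OF time_derivative p, of x s]
      by (simp add: scaleR_conv_of_real[symmetric] mult.assoc)
    show "integrable lborel (\<lambda>x. K * (lin x * E x))"
      by (intro integrable_mult_right integrable_weight \<gamma>)
    show "integrable lborel (\<lambda>x. norm (u s x) powr (p + 2))" for s
      using decays_integrable[OF decays_potential[of "\<lambda>_::unit. s"]] .
    show "(\<lambda>x. (p + 2) * (\<phi> t x \<bullet> ut t x)) \<in> borel_measurable lborel"
      using wdecays_integrable[OF d] by (rule borel_measurable_integrable)
    show "\<bar>(p + 2) * (\<phi> s x \<bullet> ut s x)\<bar> \<le> K * (lin x * E x)" for s x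
      using K by (simp only: real_norm_def)
  qed
  then show ?thesis by simp
qed

lemma energy_eq: "energy p (u t) = kinetic t - 2 / (p + 2) * potential t"
  by (simp add: energy_def kinetic_def potential_def power2_norm_eq_inner)

lemma energy_conserved: "energy p (u s) = energy p (u t)"
proof -
  have "((\<lambda>t. kinetic t - 2 / (p + 2) * potential t) has_real_derivative 0) (at t)" for t
  proof -
    have i: "integrable lborel (\<lambda>x. ut t x \<bullet> L t x)" "integrable lborel (\<lambda>x. \<phi> t x \<bullet> ut t x)"
      using decays_integrable[OF decays_inner[OF decays_ut[of "\<lambda>_::unit. t"] decays_L[of "\<lambda>_. t"]]]
        decays_integrable[OF decays_inner[OF decays_\<phi>[of "\<lambda>_::unit. t"] decays_ut[of "\<lambda>_. t"]]] by simp_all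
    \<comment> \<open>By the equation this is \<open>w \<bullet> (\<i> * w)\<close> with
      \<open>w = L t x + \<phi> t x\<close>.\<close>
    have "ut t x \<bullet> L t x + \<phi> t x \<bullet> ut t x = 0" for x
    proof -
      have "ut t x \<bullet> L t x + \<phi> t x \<bullet> ut t x = (L t x + \<phi> t x) \<bullet> ut t x"
        using inner_commute[of "ut t x" "L t x"] by (simp only: inner_add_left)
      moreover have "w \<bullet> (\<i> * w) = 0" for w :: complex by (simp add: inner_complex_def)
      ultimately show ?thesis unfolding equation by simp
    qed
    then have "(LINT x|lborel. ut t x \<bullet> L t x) + (LINT x|lborel. \<phi> t x \<bullet> ut t x) = 0"
      using i by (simp flip: Bochner_Integration.integral_add)
    moreover have "2 / (p + 2) * ((p + 2) * I) = 2 * I" for I using p by simp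
    ultimately have "- 2 * (LINT x|lborel. ut t x \<bullet> L t x) - 2 / (p + 2) * ((p + 2) * (LINT x|lborel. \<phi> t x \<bullet> ut t x)) = 0"
      by simp
    then show ?thesis
      using DERIV_diff[OF kinetic_derivative DERIV_cmult[OF potential_derivative, of "2 / (p + 2)"], of t] by simp
  qed
  then have "kinetic s - 2 / (p + 2) * potential s = kinetic t - 2 / (p + 2) * potential t"
    by (intro DERIV_isconst_all) blast
  then show ?thesis by (simp add: energy_eq)
qed

subsection \<open>Periodic solutions\<close>

lemma momentum_component: "momentum (u t) $ j = mom (axis j 1) 0 t"
proof -
  have "(\<Sum>k\<in>UNIV. (axis j 1 $ k + 0 * x $ k) * ((\<i> * u t x) \<bullet> du k t x)) = Im (cnj (u t x) * du j t x)" for x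
  proof -
    have "(\<Sum>k\<in>UNIV. (axis j 1 $ k + 0 * x $ k) * ((\<i> * u t x) \<bullet> du k t x))
       = (\<Sum>k\<in>UNIV. if k = j then (\<i> * u t x) \<bullet> du k t x else 0)"
      by (intro sum.cong) (auto simp: axis_def)
    also have "\<dots> = Im (cnj (u t x) * du j t x)" by (simp add: inner_complex_def)
    finally show ?thesis .
  qed
  moreover have "integrable lborel (\<lambda>x. cnj (u t x) * du j t x)"
  proof -
    have "decays (\<lambda>_::unit. \<lambda>x. cnj (u t x))"
      using decays_u[of "\<lambda>_::unit. t"] by (auto simp: dominated_def intro!: continuous_intros)
    from dominated_mult[OF this decays_du[of j "\<lambda>_. t"]]
    have "dominated (\<lambda>x. E x * E x) (\<lambda>_::unit. \<lambda>x. cnj (u t x) * du j t x)" by simp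
    then have "decays (\<lambda>_::unit. \<lambda>x. cnj (u t x) * du j t x)"
      by (rule dominated_mono) (use E_le_1 in \<open>auto intro: mult_left_le\<close>)
    then show ?thesis by (rule decays_integrable)
  qed
  then have "Im (LINT x|lborel. cnj (u t x) * du j t x) = (LINT x|lborel. Im (cnj (u t x) * du j t x))"
    by (rule integral_Im[symmetric])
  ultimately show ?thesis unfolding momentum_def mom_def vec_lambda_beta by simp
qed

lemma periodic_momentum_eq_0:
  assumes T: "0 < T" and per: "\<And>t x. u (t + T) x = u t x"
  shows "momentum (u t) = 0"
proof -
  have "momentum (u t) $ j = 0" for j
  proof -
    let ?W = "\<lambda>t. LINT x|lborel. (0 + axis j 1 \<bullet> x) * (u t x \<bullet> u t x)"
    obtain s where "?W T - ?W 0 = (T - 0) * (2 * mom (axis j 1) 0 s)"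
      using MVT2[OF T, of ?W "\<lambda>t. 2 * mom (axis j 1) 0 t"] weighted_mass_derivative[of 0 "axis j 1"] by blast
    moreover have "?W T = ?W 0" using per[of 0] by simp
    ultimately have "mom (axis j 1) 0 s = 0" using T by simp
    moreover have "mom (axis j 1) 0 t = mom (axis j 1) 0 s"
      using mom_derivative[of "axis j 1" 0] by (intro DERIV_isconst_all) simp
    ultimately show ?thesis by (simp add: momentum_component)
  qed
  then show ?thesis by (simp add: vec_eq_iff)
qed

text \<open>Conservation of mass prevents a solution that is nonzero somewhere from vanishing
  identically at another time.\<close>

lemma potential_pos:
  assumes "u t0 x0 \<noteq> 0"
  shows "0 < potential t"
proof -
  let ?m = "\<lambda>t. LINT x|lborel. (1 + 0 \<bullet> x) * (u t x \<bullet> u t x)"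
  have "?m t = ?m t0"
    using weighted_mass_derivative[of 1 0] by (intro DERIV_isconst_all) (simp add: mom_def)
  then have m: "(LINT x|lborel. u t x \<bullet> u t x) = (LINT x|lborel. u t0 x \<bullet> u t0 x)" by simp
  have "0 < (LINT x|lborel. u t0 x \<bullet> u t0 x)"
    by (rule integral_pos_of_continuous[where x = x0])
       (use assms in \<open>auto intro!: decays_integrable[OF decays_inner[OF decays_u[of "\<lambda>_::unit. t0"] decays_u[of "\<lambda>_. t0"]]] continuous_intros partials\<close>)
  then obtain x where x: "u t x \<noteq> 0"
    using m by (metis (no_types, lifting) inner_zero_left integral_zero Bochner_Integration.integral_cong less_irrefl)
  have c: "continuous_on UNIV (\<lambda>x. norm (u t x) powr (p + 2))"
    by (rule dominated_cont[OF decays_potential[of "\<lambda>_::unit. t"]])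
  show ?thesis
    unfolding potential_def
    by (rule integral_pos_of_continuous[OF decays_integrable[OF decays_potential[of "\<lambda>_::unit. t"]] c, of x]) (use x in auto)
qed

text \<open>\<open>N\<close> is \<open>potential s / (2 * (p + 2))\<close> at the single time
  \<open>s\<close> found by the mean value theorem. It is the same for all \<open>t\<close>, so the
  sign of the energy is that of \<open>n p - 4\<close> at every time.\<close>

lemma periodic_energy:
  assumes T: "0 < T" and per: "\<And>t x. u (t + T) x = u t x" and nz: "u t0 x0 \<noteq> 0"
  obtains N where "0 < N" "\<And>t. energy p (u t) = (real CARD('n) * p - 4) * N"
proof -
  let ?n = "real CARD('n)"
  obtain s where s: "mom 0 1 T - mom 0 1 0 = (T - 0) * (2 * 1 * kinetic s - ?n * 1 * p / (p + 2) * potential s)"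
    using MVT2[OF T, of "mom 0 1" "\<lambda>s. 2 * 1 * kinetic s - ?n * 1 * p / (p + 2) * potential s"]
      mom_derivative[of 0 1] by blast
  have "mom 0 1 T = mom 0 1 0" using per[of 0] by (simp add: mom_def ext[of "u T" "u 0"])
  with s T have "2 * kinetic s = ?n * p / (p + 2) * potential s" by simp
  then have "kinetic s = ?n * p / (2 * (p + 2)) * potential s" using p by (simp add: field_simps)
  then have "energy p (u s) = (?n * p - 4) * (potential s / (2 * (p + 2)))"
    using p by (simp add: energy_eq field_simps)
  then have "energy p (u t) = (?n * p - 4) * (potential s / (2 * (p + 2)))" for t
    using energy_conserved[of t s] by simp
  moreover have "0 < potential s / (2 * (p + 2))" using potential_pos[OF nz] p by simp
  ultimately show ?thesis using that by blast
qed

end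

section \<open>Breathers\<close>

lemma norm_nonlinearity_le:
  assumes "norm w \<le> A * e" "0 \<le> A" "0 \<le> e" "e \<le> 1" "0 < p"
  shows "norm (of_real (norm w powr p) * w :: complex) \<le> A powr p * A * e"
proof -
  have "A * e \<le> A" using assms by (simp add: mult_left_le)
  then have "norm w powr p \<le> A powr p" using assms by (intro powr_mono2) auto
  then have "norm w powr p * norm w \<le> A powr p * (A * e)" using assms by (intro mult_mono) auto
  then show ?thesis by (simp add: norm_mult mult.assoc)
qed

text \<open>Values and gradient of \<open>u\<close> are estimated through \<open>Q\<close> and
  \<open>z\<close> together, second order quantities through \<open>z\<close> alone. The period
  \<open>T\<close> is \<open>2 * pi / \<omega>\<close>.\<close>

lemma breather_decaying_solution:
  fixes Q :: "real^'n::finite \<Rightarrow> real"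
  assumes p: "0 < p" and Q: "ground_state p Q" and u: "breather p Q u"
  shows "\<exists>C \<gamma> ut T. decaying_solution p C \<gamma> u ut \<and> 0 < T \<and> (\<forall>t x. u (t + T) x = u t x)"
proof -
  obtain \<omega> C0 \<gamma>0 z where \<omega>: "\<omega> > 0" and C0: "C0 > 0" and \<gamma>0: "\<gamma>0 > 0"
    and uz: "\<And>t x. u t x = exp (\<i> * of_real (\<omega> * t)) * (of_real (rescale p \<omega> Q x) + z t x)"
    and pert: "perturbation_solution p \<omega> (rescale p \<omega> Q) z"
    and per: "\<And>t x. u (t + 2 * pi / \<omega>) x = u t x"
    and zb: "\<And>x is t. length is \<le> 2 \<Longrightarrow> norm (iter_partial is (z t) x) \<le> C0 * exp (- \<gamma>0 * norm x)"
    using u unfolding breather_def by blast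
  have nls: "NLS_solution p u" using u by (simp add: breather_def)
  obtain C1 \<gamma>1 where C1: "C1 > 0" and \<gamma>1: "\<gamma>1 > 0"
    and Qb: "\<And>x. \<bar>Q x\<bar> \<le> C1 * exp (- \<gamma>1 * norm x)" "\<And>k x. \<bar>partial k Q x\<bar> \<le> C1 * exp (- \<gamma>1 * norm x)"
    using ground_state_gradient_decay[OF Q p] by blast
  define q where "q = rescale p \<omega> Q"
  define q' where "q' k x = \<omega> powr (1 / p) * (sqrt \<omega> * partial k Q (sqrt \<omega> *\<^sub>R x))" for k x
  have C2: "C_k 2 (u t)" "C_k 2 (z t)" for t
    using nls pert by (auto simp: NLS_solution_def perturbation_solution_def)
  have "C_k 2 Q" using Q by (simp add: ground_state_def)
  then have "has_partial k q (q' k)" for k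
    using has_partial_mult_left[OF has_partial_scale[OF C_k_2_has_partials(1)[of Q k], of "sqrt \<omega>"], of "\<omega> powr (1 / p)"]
    by (simp add: q_def rescale_def[abs_def] q'_def[abs_def])
  then have "has_partial k (u t) (\<lambda>x. exp (\<i> * of_real (\<omega> * t)) * (of_real (q' k x) + partial k (z t) x))" for k t
    unfolding uz q_def[symmetric]
    by (intro has_partial_mult_left has_partial_add has_partial_of_real C_k_2_has_partials C2)
  then have du: "partial k (u t) = (\<lambda>x. exp (\<i> * of_real (\<omega> * t)) * (of_real (q' k x) + partial k (z t) x))" for k t
    by (intro has_partial_unique[OF C_k_2_has_partials(1)[OF C2(1)]])
  \<comment> \<open>Rescaling space by \<open>sqrt \<omega>\<close> multiplies the decay rate of
    \<open>Q\<close> by the same factor.\<close>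
  define \<gamma> where "\<gamma> = min \<gamma>0 (\<gamma>1 * sqrt \<omega>)"
  have \<gamma>: "\<gamma> > 0" using \<gamma>0 \<gamma>1 \<omega> by (simp add: \<gamma>_def)
  let ?E = "\<lambda>x::real^'n. exp (- \<gamma> * norm x)"
  have E1: "?E x \<le> 1" for x using \<gamma> by simp
  have Ez: "exp (- \<gamma>0 * norm x) \<le> ?E x" for x :: "real^'n"
    by (simp add: \<gamma>_def mult_right_mono)
  have EQ: "exp (- \<gamma>1 * norm (sqrt \<omega> *\<^sub>R x)) \<le> ?E x" for x :: "real^'n"
    using \<omega> by (simp add: \<gamma>_def mult.assoc[symmetric] mult_right_mono)
  \<comment> \<open>The factor \<open>1 + sqrt \<omega>\<close> serves both \<open>q\<close> and its
    gradient, which gains \<open>sqrt \<omega>\<close> from the chain rule.\<close>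
  define B where "B = \<omega> powr (1 / p) * (1 + sqrt \<omega>) * C1"
  have B: "B \<ge> 0" using \<omega> C1 by (simp add: B_def)
  have qb: "\<bar>q x\<bar> \<le> B * ?E x" for x
  proof -
    have "\<bar>q x\<bar> \<le> \<omega> powr (1 / p) * (C1 * exp (- \<gamma>1 * norm (sqrt \<omega> *\<^sub>R x)))"
      unfolding q_def rescale_def abs_mult using \<omega> by (intro mult_mono Qb) auto
    also have "\<dots> \<le> \<omega> powr (1 / p) * (C1 * ?E x)"
      using C1 by (intro mult_left_mono EQ) auto
    also have "\<dots> \<le> B * ?E x"
      using C1 \<omega> unfolding B_def by (simp add: algebra_simps)
    finally show ?thesis .
  qed
  have q'b: "\<bar>q' k x\<bar> \<le> B * ?E x" for k x
  proof -
    have "\<bar>q' k x\<bar> \<le> \<omega> powr (1 / p) * (sqrt \<omega> * (C1 * exp (- \<gamma>1 * norm (sqrt \<omega> *\<^sub>R x))))"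
      unfolding q'_def abs_mult using \<omega> by (intro mult_mono Qb) auto
    also have "\<dots> \<le> \<omega> powr (1 / p) * (sqrt \<omega> * (C1 * ?E x))"
      using C1 \<omega> by (intro mult_left_mono EQ) auto
    also have "\<dots> \<le> B * ?E x"
      using C1 \<omega> unfolding B_def by (simp add: algebra_simps)
    finally show ?thesis .
  qed
  have zE: "norm (iter_partial is (z t) x) \<le> C0 * ?E x" if "length is \<le> 2" for "is" t x
    using zb[OF that, of t x] mult_left_mono[OF Ez[of x], of C0] C0 by linarith
  have z0: "norm (z t x) \<le> C0 * ?E x" for t x using zE[of "[]"] by (simp add: iter_partial_def)
  have z1: "norm (partial k (z t) x) \<le> C0 * ?E x" for k t x using zE[of "[k]"] by (simp add: iter_partial_def)
  have z2: "norm (partial k (partial k (z t)) x) \<le> C0 * ?E x" for k t x using zE[of "[k, k]"] by (simp add: iter_partial_def)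
  define A where "A = B + C0"
  have A: "A \<ge> 0" using B C0 by (simp add: A_def)
  define v where "v t x = of_real (q x) + z t x" for t x
  have uv: "u t x = exp (\<i> * of_real (\<omega> * t)) * v t x" for t x by (simp add: uz v_def q_def)
  have ph: "norm (exp (\<i> * of_real r)) = 1" for r by simp
  have vb: "norm (v t x) \<le> A * ?E x" for t x
    using norm_triangle_ineq[of "of_real (q x)" "z t x"] qb[of x] z0[of t x] by (simp add: v_def A_def algebra_simps)
  \<comment> \<open>Derivative and equation are bundled so that one choice of \<open>zt\<close>
    satisfies both.\<close>
  define P where "P t x w \<longleftrightarrow> ((\<lambda>s. z s x) has_vector_derivative w) (at t) \<and>
        \<i> * w - of_real \<omega> * z t x + laplacian (z t) x =
          - (of_real (norm (v t x) powr p) * v t x) + of_real (\<bar>q x\<bar> powr p * q x)" for t x w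
  have "\<exists>w. P t x w" for t x
    using pert unfolding P_def perturbation_solution_def v_def q_def by blast
  then obtain zt where "P t x (zt t x)" for t x by metis
  then have zt: "((\<lambda>s. z s x) has_vector_derivative zt t x) (at t)"
    and zeq: "\<i> * zt t x - of_real \<omega> * z t x + laplacian (z t) x =
          - (of_real (norm (v t x) powr p) * v t x) + of_real (\<bar>q x\<bar> powr p * q x)" for t x
    unfolding P_def by blast+
  define D where "D = \<omega> * C0 + real CARD('n) * C0 + A powr p * A + B powr p * B"
  \<comment> \<open>Reading \<open>zt\<close> off the equation for \<open>z\<close> involves the
    Laplacian of \<open>z\<close>, whose decay belongs to the definition of a breather; the equation
    for \<open>u\<close> would also bring in that of \<open>Q\<close>.\<close>
  have ztb: "norm (zt t x) \<le> D * ?E x" for t x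
  proof -
    have "norm (zt t x) = norm (\<i> * zt t x)" by (simp add: norm_mult)
    also have "\<i> * zt t x = (of_real \<omega> * z t x - laplacian (z t) x) + (of_real (\<bar>q x\<bar> powr p * q x) - of_real (norm (v t x) powr p) * v t x)"
      using zeq[of t x] by (simp add: algebra_simps)
    also have "norm \<dots> \<le> (norm (of_real \<omega> * z t x) + norm (laplacian (z t) x))
        + (norm (of_real (\<bar>q x\<bar> powr p * q x) :: complex) + norm (of_real (norm (v t x) powr p) * v t x))"
      by (intro norm_triangle_mono norm_triangle_ineq4)
    also have "\<dots> \<le> (\<omega> * (C0 * ?E x) + real CARD('n) * (C0 * ?E x)) + (B powr p * B * ?E x + A powr p * A * ?E x)"
    proof (intro add_mono)
      show "norm (of_real \<omega> * z t x) \<le> \<omega> * (C0 * ?E x)"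
        using \<omega> mult_left_mono[OF z0[of t x], of \<omega>] by (simp add: norm_mult)
      show "norm (laplacian (z t) x) \<le> real CARD('n) * (C0 * ?E x)"
        unfolding laplacian_def by (rule sum_norm_bound) (rule z2)
      have "norm (of_real (norm (of_real (q x) :: complex) powr p) * of_real (q x) :: complex) \<le> B powr p * B * ?E x"
        by (rule norm_nonlinearity_le) (use qb[of x] B E1 p in auto)
      then show "norm (of_real (\<bar>q x\<bar> powr p * q x) :: complex) \<le> B powr p * B * ?E x" by simp
      show "norm (of_real (norm (v t x) powr p) * v t x) \<le> A powr p * A * ?E x"
        by (rule norm_nonlinearity_le) (use vb[of t x] A E1 p in auto)
    qed
    also have "\<dots> = D * ?E x" by (simp add: D_def algebra_simps)
    finally show ?thesis .
  qed
  define ut where "ut t x = exp (\<i> * of_real (\<omega> * t)) * (\<i> * of_real \<omega> * v t x + zt t x)" for t x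
  have dut: "((\<lambda>s. u s x) has_vector_derivative ut t x) (at t)" for t x
  proof -
    have "((\<lambda>s. exp (\<i> * of_real (\<omega> * s))) has_vector_derivative (\<i> * of_real \<omega>) * exp (\<i> * of_real (\<omega> * t))) (at t)"
      using exp_scaleR_has_vector_derivative_right[of "\<i> * of_real \<omega>" t UNIV]
      by (simp add: scaleR_conv_of_real mult_ac)
    moreover have "((\<lambda>s. v s x) has_vector_derivative 0 + zt t x) (at t)"
      unfolding v_def by (intro has_vector_derivative_add zt has_vector_derivative_const)
    ultimately have "((\<lambda>s. exp (\<i> * of_real (\<omega> * s)) * v s x) has_vector_derivative
        exp (\<i> * of_real (\<omega> * t)) * (0 + zt t x) + (\<i> * of_real \<omega>) * exp (\<i> * of_real (\<omega> * t)) * v t x) (at t)"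
      by (rule has_vector_derivative_mult)
    then show ?thesis unfolding uv ut_def by (simp add: algebra_simps)
  qed
  define C where "C = A + (\<omega> * A + D)"
  have D: "D \<ge> 0" using A B C0 \<omega> by (simp add: D_def)
  have "decaying_solution p C \<gamma> u ut"
  proof
    fix t x k
    show "ut t x = \<i> * (laplacian (u t) x + of_real (norm (u t x) powr p) * u t x)"
    proof -
      obtain w where w: "((\<lambda>s. u s x) has_vector_derivative w) (at t)"
        "\<i> * w + laplacian (u t) x = - (of_real (norm (u t x) powr p) * u t x)"
        using nls unfolding NLS_solution_def by blast
      have "w = ut t x" using vector_derivative_unique_at[OF w(1) dut] .
      then have "\<i> * (\<i> * ut t x) = \<i> * (- laplacian (u t) x - of_real (norm (u t x) powr p) * u t x)"
        using w(2) by (metis (no_types, lifting) add.commute add_diff_cancel_right' diff_conv_add_uminus)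
      then show ?thesis by (simp add: algebra_simps)
    qed
    have AC: "A * ?E x \<le> C * ?E x" using A D \<omega> by (intro mult_right_mono) (auto simp: C_def)
    show "norm (u t x) \<le> C * ?E x"
      using order_trans[OF vb AC] by (simp add: uv norm_mult)
    have "norm (of_real (q' k x) + partial k (z t) x) \<le> A * ?E x"
      using norm_triangle_ineq[of "of_real (q' k x)" "partial k (z t) x"] q'b[of k x] z1[of k t x] by (simp add: A_def algebra_simps)
    from order_trans[OF this AC] show "norm (partial k (u t) x) \<le> C * ?E x"
      by (simp add: du norm_mult)
    have "norm (\<i> * of_real \<omega> * v t x) = \<omega> * norm (v t x)" using \<omega> by (simp add: norm_mult)
    moreover have "\<omega> * norm (v t x) \<le> \<omega> * (A * ?E x)" using \<omega> by (intro mult_left_mono vb) auto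
    ultimately have "norm (\<i> * of_real \<omega> * v t x + zt t x) \<le> \<omega> * (A * ?E x) + D * ?E x"
      using norm_triangle_ineq[of "\<i> * of_real \<omega> * v t x" "zt t x"] ztb[of t x] by linarith
    also have "\<dots> \<le> C * ?E x" using A by (simp add: C_def algebra_simps)
    finally show "norm (ut t x) \<le> C * ?E x" by (simp add: ut_def norm_mult)
    \<comment> \<open>The uniform second order bound is available for \<open>z\<close>; the formula
      \<open>du\<close> then carries the limit over to \<open>u\<close>, since \<open>q'\<close> is
      independent of time.\<close>
    have "((\<lambda>s. partial k (z s) x) \<longlongrightarrow> partial k (z t) x) (at t)"
    proof (rule partial_tendsto[where k = k and z = z and z'' = "\<lambda>s. partial k (partial k (z s))" and M = C0])
      show "((\<lambda>s. z s x) \<longlongrightarrow> z t x) (at t)" for x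
        using has_vector_derivative_continuous[OF zt] by (simp add: isCont_def)
      show "norm (partial k (partial k (z s)) x) \<le> C0" for s x
        using order_trans[OF z2 mult_left_mono[OF E1]] C0 by simp
    qed (intro C_k_2_has_partials C2)+
    then show "((\<lambda>s. partial k (u s) x) \<longlongrightarrow> partial k (u t) x) (at t)"
      unfolding du by (intro tendsto_intros)
  qed (use p \<gamma> C2 dut in auto)
  moreover have "0 < 2 * pi / \<omega>" using \<omega> by simp
  ultimately show ?thesis using per by blast
qed

theorem corollary2p4:
  fixes p :: real
    and Q :: "real^'n::finite \<Rightarrow> real"
    and u :: "real \<Rightarrow> real^'n \<Rightarrow> complex"
  assumes "0 < p" and "ereal p < energy_critical_power CARD('n)"
    and "ground_state p Q"
    and "breather p Q u"
  shows "(\<forall>t. momentum (u t) = 0) \<and>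
    ((\<forall>t. energy p (u t) < 0) \<and> p < 4 / real CARD('n) \<or>
     (\<forall>t. energy p (u t) = 0) \<and> p = 4 / real CARD('n) \<or>
     (\<forall>t. energy p (u t) > 0) \<and> 4 / real CARD('n) < p \<and>
        ereal p < energy_critical_power CARD('n))"
proof -
  obtain C \<gamma> ut T where ds: "decaying_solution p C \<gamma> u ut" and T: "0 < T" "\<And>t x. u (t + T) x = u t x"
    using breather_decaying_solution[OF assms(1,3,4)] by blast
  obtain t0 x0 where "u t0 x0 \<noteq> 0" using assms(4) by (auto simp: breather_def)
  then obtain N where N: "0 < N" "\<And>t. energy p (u t) = (real CARD('n) * p - 4) * N"
    using decaying_solution.periodic_energy[OF ds T] by blast
  have n: "0 < real CARD('n)" by simp
  consider "p < 4 / real CARD('n)" | "p = 4 / real CARD('n)" | "4 / real CARD('n) < p" by linarith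
  then have "(\<forall>t. energy p (u t) < 0) \<and> p < 4 / real CARD('n) \<or>
     (\<forall>t. energy p (u t) = 0) \<and> p = 4 / real CARD('n) \<or>
     (\<forall>t. energy p (u t) > 0) \<and> 4 / real CARD('n) < p"
  proof cases
    case 1
    then have "real CARD('n) * p - 4 < 0" using n by (simp add: pos_less_divide_eq mult.commute)
    then show ?thesis using 1 N by (simp add: mult_neg_pos)
  next
    case 2
    then have "real CARD('n) * p - 4 = 0" using n by simp
    then show ?thesis using 2 N by simp
  next
    case 3
    then have "real CARD('n) * p - 4 > 0" using n by (simp add: pos_divide_less_eq mult.commute)
    then show ?thesis using 3 N by simp
  qed
  then show ?thesis
    using decaying_solution.periodic_momentum_eq_0[OF ds T] assms(2) by blast
qed

end
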